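(* Let $p(z)=a_0z^n+a_1z^{n-1}+\dots+a_n$ be a given real polynomial of degree $n\geqslant1$ with $a_0>0$, and let $l=\left[\frac n2\right]$. The polynomial $p$ is generalized Hurwitz if and only if its associated function $\Phi$ is an $R$-function with exactly $l$ poles (for $a_1\neq0$) or exactly $l-1$ poles (for $a_1=0$). (If $n=2l$ and $\Phi$ is an $R$-function, then $a_1\neq0$, so $\Phi$ has exactly $l$ poles.) Moreover, - if $n=2l$, or if $n=2l+1$ with $a_0a_1>0$, then the number of nonnegative poles of the function $\Phi$ equals the order of $p$; - if $n=2l+1$ with $a_0a_1\leqslant0$, then the number of nonnegative poles of the function $\Phi$ equals the order of $p$ minus one.
   Context: Here $[\rho]$ denotes the largest integer not exceeding $\rho$. Write $p(z)=p_0(z^2)+zp_1(z^2)$ with real polynomials $p_0,p_1$ (the even and odd parts of $p$). The function associated with $p$ is $\Phi(u)=p_1(u)/p_0(u)$. A rational function $F$ is called an $R$-function if it maps the upper half-plane of the complex plane to the lower half-plane, i.e. $\operatorname{Im}z>0$ implies $\operatorname{Im}F(z)<0$. A real polynomial $p$ of degree $n$ with positive leading coefficient is called generalized Hurwitz (of type I) of order $k$, where $0\leqslant k\leqslant\left[\frac{n+1}2\right]$, if: (i) it has exactly $k$ zeroes in the closed right half-plane, all of which are nonnegative and simple: $0\leqslant\mu_1<\mu_2<\dots<\mu_k$; (ii) $p(-\mu_i)\neq0$ for every positive $\mu_i$; (iii) $p$ has an odd number of zeroes, counting multiplicities, on each interval $(-\mu_k,-\mu_{k-1}),\dots,(-\mu_3,-\mu_2),(-\mu_2,-\mu_1)$;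 (iv) the number of zeroes of $p$ on the interval $(-\mu_1,0)$ (if any) is even, counting multiplicities; (v) the other real zeroes lie on the interval $(-\infty,-\mu_k)$: an odd number of zeroes, counting multiplicities, when $n=2l$, and an even number of zeroes, counting multiplicities, when $n=2l+1$; (vi) all nonreal zeroes of $p$ (if any) are located in the open left half-plane. For $k=0$ this means that $p$ has no zeroes in the closed right half-plane, i.e. $p$ is Hurwitz stable, conditions (ii)-(v) being void. "Generalized Hurwitz" means generalized Hurwitz of type I of some order.
   Formalization: The equivalence is proved for n ≥ 2; for n = 1 it fails (p = z+1 has constant Φ) and p is shown to be always generalized Hurwitz. "Exactly l poles" in the parenthesis is proved for coprime p_0, p_1, since it fails for p = z^4+z^3−z−1. *)

theory Defs
  imports "HOL-Complex_Analysis.Complex_Analysis" "HOL-Computational_Algebra.Computational_Algebra"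
begin

definition even_part :: "real poly \<Rightarrow> real poly" where
  "even_part p = (\<Sum>i\<le>degree p. monom (coeff p (2 * i)) i)"

definition odd_part :: "real poly \<Rightarrow> real poly" where
  "odd_part p = (\<Sum>i\<le>degree p. monom (coeff p (2 * i + 1)) i)"

lemma coeff_even_part: "coeff (even_part p) i = coeff p (2 * i)"
  by (cases "i \<le> degree p") (auto simp: even_part_def coeff_sum coeff_eq_0)

lemma coeff_odd_part: "coeff (odd_part p) i = coeff p (2 * i + 1)"
  by (cases "i \<le> degree p") (auto simp: odd_part_def coeff_sum coeff_eq_0)

lemma even_odd_decomposition:
  "p = pcompose (even_part p) (monom 1 2) + monom 1 1 * pcompose (odd_part p) (monom 1 2)"
proof -
  have "poly p x = poly (even_part p) (x ^ 2) + x * poly (odd_part p) (x ^ 2)" for x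
  proof -
    have "poly p x = (\<Sum>j<2 * (degree p + 1). coeff p j * x ^ j)"
      unfolding poly_altdef by (rule sum.mono_neutral_left) (auto simp: coeff_eq_0)
    also have "\<dots> = (\<Sum>i<m. coeff p (2*i) * x ^ (2*i) + coeff p (2*i+1) * x ^ (2*i+1))"
      if "m = degree p + 1" for m
      unfolding that[symmetric] by (induction m) simp_all
    finally have "poly p x = (\<Sum>i\<le>degree p. coeff p (2*i) * x ^ (2*i) + coeff p (2*i+1) * x ^ (2*i+1))"
      by (simp add: lessThan_Suc_atMost)
    then show ?thesis
      by (simp add: even_part_def odd_part_def poly_sum poly_monom sum.distrib
          sum_distrib_left algebra_simps flip: power_mult)
  qed
  then show ?thesis
    by (intro poly_eq_poly_eq_iff[THEN iffD1] ext) (simp add: poly_pcompose poly_monom)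
qed

text \<open>
  A rational function is represented by its values on the complex plane. Applying
  \<^const>\<open>remove_sings\<close> cancels common factors of numerator and denominator (so the value at a
  common zero is the limit, not \<open>0 / 0 = 0\<close>); at genuine poles the value is the dummy \<open>0\<close>.
\<close>

definition rational_fun :: "(complex \<Rightarrow> complex) \<Rightarrow> bool" where
  "rational_fun F \<longleftrightarrow>
     (\<exists>P Q. Q \<noteq> 0 \<and> F = remove_sings (\<lambda>u. poly P u / poly Q u))"

text \<open>If \<open>even_part p = 0\<close>, the quotient is undefined; \<open>assoc_fun p\<close> is then the zero function,
  which is not an R-function and has no poles.\<close>

definition assoc_fun :: "real poly \<Rightarrow> complex \<Rightarrow> complex" where
  "assoc_fun p = remove_sings (\<lambda>u. poly (map_poly complex_of_real (odd_part p)) u /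
                                   poly (map_poly complex_of_real (even_part p)) u)"

text \<open>The strict inequality excludes real constants. In particular, for \<open>degree p = 1\<close> the function
  \<open>assoc_fun p\<close> is a real constant and hence never an R-function, although \<open>p\<close> is generalized
  Hurwitz.\<close>

definition R_function :: "(complex \<Rightarrow> complex) \<Rightarrow> bool" where
  "R_function F \<longleftrightarrow> rational_fun F \<and> (\<forall>z. Im z > 0 \<longrightarrow> \<not> is_pole F z \<and> Im (F z) < 0)"

definition zeros_on :: "real poly \<Rightarrow> real set \<Rightarrow> nat" where
  "zeros_on p I = size {#x \<in># proots p. x \<in> I#}"

text \<open>The zeros in the closed right half-plane are \<open>\<mu> 1 < \<dots> < \<mu> k\<close>; other values of \<open>\<mu>\<close> are
  irrelevant.\<close>

definition gen_hurwitz_order :: "real poly \<Rightarrow> nat \<Rightarrow> bool" where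
  "gen_hurwitz_order p k \<longleftrightarrow>
     lead_coeff p > 0 \<and> k \<le> (degree p + 1) div 2 \<and>
     (\<exists>\<mu> :: nat \<Rightarrow> real.
        \<comment> \<open>(i)\<close>
        strict_mono_on {1..k} \<mu> \<and>
        {z. poly (map_poly complex_of_real p) z = 0 \<and> Re z \<ge> 0} = (\<lambda>i. complex_of_real (\<mu> i)) ` {1..k} \<and>
        (\<forall>i\<in>{1..k}. \<mu> i \<ge> 0 \<and> order (\<mu> i) p = 1) \<and>
        \<comment> \<open>(ii)\<close>
        (\<forall>i\<in>{1..k}. \<mu> i > 0 \<longrightarrow> poly p (- \<mu> i) \<noteq> 0) \<and>
        \<comment> \<open>(iii)\<close>
        (\<forall>i\<in>{1..<k}. odd (zeros_on p {- \<mu> (i + 1)<..<- \<mu> i})) \<and>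
        (k \<ge> 1 \<longrightarrow>
           \<comment> \<open>(iv)\<close>
           even (zeros_on p {- \<mu> 1<..<0}) \<and>
           \<comment> \<open>(v)\<close>
           (\<forall>x. poly p x = 0 \<longrightarrow>
              x \<in> \<mu> ` {1..k} \<union> (\<Union>i\<in>{1..<k}. {- \<mu> (i + 1)<..<- \<mu> i}) \<union> {- \<mu> 1<..<0} \<union> {..<- \<mu> k}) \<and>
           (if even (degree p) then odd (zeros_on p {..<- \<mu> k})
            else even (zeros_on p {..<- \<mu> k}))) \<and>
        \<comment> \<open>(vi)\<close>
        (\<forall>z. poly (map_poly complex_of_real p) z = 0 \<and> z \<notin> \<real> \<longrightarrow> Re z < 0))"

definition generalized_hurwitz :: "real poly \<Rightarrow> bool" where
  "generalized_hurwitz p \<longleftrightarrow> (\<exists>k. gen_hurwitz_order p k)"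

text \<open>Poles in the finite plane only; a pole at infinity is not counted. Poles are counted without
  multiplicity, which makes no difference for R-functions, all of whose poles are simple.\<close>

definition num_poles :: "(complex \<Rightarrow> complex) \<Rightarrow> nat" where
  "num_poles F = card {u. is_pole F u}"

definition num_nonneg_poles :: "(complex \<Rightarrow> complex) \<Rightarrow> nat" where
  "num_nonneg_poles F = card {u \<in> \<real>\<^sub>\<ge>\<^sub>0. is_pole F u}"

end

theory Submission
  imports Defs "HOL-Computational_Algebra.Field_as_Ring"
begin

text \<open>
  Write \<open>p(z) = e(z\<^sup>2) + z f(z\<^sup>2)\<close> with even part \<open>e\<close> and odd part \<open>f\<close>, so that \<open>\<Phi> = f/e\<close>. Two facts
  link the zeros of \<open>p\<close> to \<open>\<Phi>\<close>: where \<open>e(z\<^sup>2) \<noteq> 0\<close>, the equation \<open>p(z) = 0\<close> says \<open>\<Phi>(z\<^sup>2) = -1/z\<close>; and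
  \<open>p(-\<mu>) = 2 e(\<mu>\<^sup>2)\<close> at a zero \<open>\<mu>\<close> of \<open>p\<close>.

  From \<open>\<Phi>\<close> to \<open>p\<close>. If \<open>\<Phi>\<close> is an R-function with as many poles as \<open>e\<close> can have zeros, then \<open>e\<close> and \<open>f\<close> have
  no common zero and all zeros of \<open>e\<close> are real. For \<open>z\<close> in the open first quadrant, \<open>z\<^sup>2\<close> and \<open>-1/z\<close> both lie
  in the upper half-plane, so \<open>\<Phi>(z\<^sup>2) = -1/z\<close> is impossible; on the imaginary axis, \<open>p(iy) = 0\<close> with \<open>y \<noteq> 0\<close>
  would be a common zero of \<open>e\<close> and \<open>f\<close>. Hence the zeros of \<open>p\<close> in the closed right half-plane are real.
  An R-function is nonincreasing between its real poles, and this gives \<open>p(-\<mu>) p'(\<mu>) < 0\<close> at every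
  positive zero \<open>\<mu>\<close> (\<open>decreasing_quotient_sign\<close>). So the nonnegative zeros are simple, the signs of \<open>p'\<close>
  alternate along them, hence so do the signs of \<open>p\<close> at the points \<open>-\<mu>\<^sub>i\<close>, and sign changes are
  the same thing as odd numbers of zeros (\<open>generalized_hurwitzI\<close>).

  From \<open>p\<close> to \<open>\<Phi>\<close>. It suffices to find as many distinct real zeros of \<open>e\<close> as its degree, with \<open>f\<close> of alternating
  sign along them: then \<open>f/e\<close> is a sum of a nonincreasing linear function and of fractions \<open>\<gamma>/(u - x)\<close>
  with \<open>\<gamma> > 0\<close> (\<open>alternating_imp_R_function\<close>). The nonnegative zeros of \<open>e\<close> come from the signs of
  \<open>p(-\<mu>\<^sub>i)\<close>, one zero for each interval between consecutive \<open>\<mu>\<^sub>i\<^sup>2\<close> and, depending on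
  the sign of the leading coefficient of \<open>e\<close>, one beyond the last \<open>\<mu>\<^sub>k\<^sup>2\<close>
  (\<open>nonneg_zero_of_even_part\<close>); this is where the orders \<open>k\<close> and \<open>k - 1\<close> come from. The negative zeros
  come from \<open>p(iy) = e(-y\<^sup>2) + iy f(-y\<^sup>2)\<close>: the argument of \<open>p(iy)\<close> is a sum of arctangents, one for each zero
  of \<open>p\<close>, so its total change for \<open>0 < y < \<infinity>\<close> is known, and each odd multiple of \<open>\<pi>/2\<close> passed on the way is
  a zero of \<open>e(-y\<^sup>2)\<close> at which the sign of \<open>f\<close> is known (\<open>negative_zeros\<close>). The two families together
  exhaust the degree of \<open>e\<close>, and their signs fit together (\<open>even_part_interlacing_zeros\<close>).
\<close>

section \<open>Real polynomials on the complex plane and their quotients\<close>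

abbreviation cpoly :: "real poly \<Rightarrow> complex poly" where
  "cpoly \<equiv> map_poly complex_of_real"

lemma coeff_cpoly [simp]: "coeff (cpoly p) i = of_real (coeff p i)"
  by (simp add: coeff_map_poly)

lemma degree_cpoly [simp]: "degree (cpoly p) = degree p"
  by (simp add: degree_map_poly)

lemma cpoly_add: "cpoly (p + q) = cpoly p + cpoly q"
  by (rule poly_eqI) simp

lemma cpoly_mult: "cpoly (p * q) = cpoly p * cpoly q"
  by (rule poly_eqI) (simp add: coeff_mult)

lemma cpoly_pderiv: "pderiv (cpoly p) = cpoly (pderiv p)"
  by (rule poly_eqI) (simp add: coeff_pderiv)

lemma cpoly_eq_0_iff [simp]: "cpoly p = 0 \<longleftrightarrow> p = 0"
  by (simp add: map_poly_eq_0_iff)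

lemma poly_cpoly_of_real [simp]: "poly (cpoly p) (of_real x) = of_real (poly p x)"
  by (simp add: poly_altdef)

lemma poly_cpoly_cnj [simp]: "poly (cpoly p) (cnj z) = cnj (poly (cpoly p) z)"
  by (simp add: poly_altdef)

lemma poly_even_odd:
  "poly p x = poly (even_part p) (x\<^sup>2) + x * poly (odd_part p) (x\<^sup>2)"
  by (subst even_odd_decomposition) (simp add: poly_pcompose poly_monom)

lemma cpoly_even_odd:
  "poly (cpoly p) z = poly (cpoly (even_part p)) (z\<^sup>2) + z * poly (cpoly (odd_part p)) (z\<^sup>2)"
proof -
  have *: "cpoly (monom a i) = monom (of_real a) i" for a i
    by (simp add: map_poly_monom)
  have comp: "poly (cpoly (pcompose q (monom 1 2))) z = poly (cpoly q) (z\<^sup>2)" for q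
  proof (induction q)
    case (pCons a q)
    then show ?case
      by (simp add: pcompose_pCons cpoly_add cpoly_mult * poly_monom map_poly_pCons)
  qed simp
  show ?thesis
    by (subst even_odd_decomposition) (simp add: cpoly_add cpoly_mult * comp poly_monom)
qed

lemma poly_even_part_square: "poly (even_part p) (x\<^sup>2) = (poly p x + poly p (- x)) / 2"
  using poly_even_odd[of p x] poly_even_odd[of p "- x"] by simp

lemma rational_not_pole:
  fixes P Q :: "complex poly"
  assumes "poly Q u \<noteq> 0"
  shows "\<not> is_pole (\<lambda>u. poly P u / poly Q u) u"
    and "remove_sings (\<lambda>u. poly P u / poly Q u) u = poly P u / poly Q u"
proof -
  have an: "(\<lambda>u. poly P u / poly Q u) analytic_on {u}"
    using assms by (intro analytic_on_divide holomorphic_on_imp_analytic_at[OF _ open_UNIV] holomorphic_intros) auto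
  then show "\<not> is_pole (\<lambda>u. poly P u / poly Q u) u"
    using analytic_at not_is_pole_holomorphic by blast
  show "remove_sings (\<lambda>u. poly P u / poly Q u) u = poly P u / poly Q u"
    using an by simp
qed

lemma rational_isolated:
  fixes P Q :: "complex poly"
  shows "isolated_singularity_at (\<lambda>u. poly P u / poly Q u) u"
    and "not_essential (\<lambda>u. poly P u / poly Q u) u"
proof -
  have an: "poly R analytic_on {u}" for R :: "complex poly"
    by (intro holomorphic_on_imp_analytic_at[OF _ open_UNIV] holomorphic_intros) auto
  have "isolated_singularity_at (poly R) u" "not_essential (poly R) u" for R :: "complex poly"
    using an by (auto intro: isolated_singularity_at_analytic not_essential_analytic)
  then show "isolated_singularity_at (\<lambda>u. poly P u / poly Q u) u"
    and "not_essential (\<lambda>u. poly P u / poly Q u) u"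
    by (auto intro!: singularity_intros)
qed

lemma rational_pole:
  fixes P Q :: "complex poly"
  assumes "Q \<noteq> 0" "poly Q u = 0" "poly P u \<noteq> 0"
  shows "is_pole (\<lambda>u. poly P u / poly Q u) u"
proof (rule is_pole_divide)
  show "isCont (poly P) u" by simp
  have "finite {x. poly Q x = 0}" using assms(1) by (rule poly_roots_finite)
  then have "eventually (\<lambda>x. poly Q x \<noteq> 0) (at u)"
    using islimpt_finite islimpt_iff_eventually
    by (metis (mono_tags, lifting) eventually_mono mem_Collect_eq)
  moreover have "(\<lambda>x. poly Q x) \<midarrow>u\<rightarrow> poly Q u" by (intro tendsto_intros)
  ultimately show "filterlim (poly Q) (at 0) (at u)"
    using assms(2) by (simp add: filterlim_at eventually_mono)
  show "poly P u \<noteq> 0" by fact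
qed

text \<open>
  A common zero of numerator and denominator cancels one factor; if the zero of the denominator is
  simple, nothing is left of it. Hence a quotient can have as many poles as its denominator has degree
  only when there is no cancellation at all.
\<close>

lemma rational_simple_root_not_pole:
  fixes P Q :: "complex poly"
  assumes "poly P u = 0" "Q \<noteq> 0" "order u Q = 1"
  shows "\<not> is_pole (\<lambda>u. poly P u / poly Q u) u"
proof -
  obtain P' where P': "P = [:-u, 1:] * P'"
    using assms(1) by (metis dvdE poly_eq_0_iff_dvd)
  obtain Q' where Q': "Q = [:-u, 1:] * Q'" and nz: "\<not> [:-u, 1:] dvd Q'"
    using order_decomp[OF assms(2), of u] unfolding assms(3) power_one_right by blast
  have "poly Q' u \<noteq> 0" using nz by (simp add: poly_eq_0_iff_dvd)
  then have "\<not> is_pole (\<lambda>u. poly P' u / poly Q' u) u" by (rule rational_not_pole)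
  moreover have "is_pole (\<lambda>u. poly P u / poly Q u) u \<longleftrightarrow> is_pole (\<lambda>u. poly P' u / poly Q' u) u"
  proof (rule is_pole_cong[OF _ refl])
    have "poly P x / poly Q x = poly P' x / poly Q' x" if "x \<noteq> u" for x
    proof -
      have "poly P x = (x - u) * poly P' x" "poly Q x = (x - u) * poly Q' x"
        by (simp_all add: P' Q' algebra_simps)
      then show ?thesis using that by simp
    qed
    then show "\<forall>\<^sub>F x in at u. poly P x / poly Q x = poly P' x / poly Q' x"
      by (simp add: eventually_at_filter)
  qed
  ultimately show ?thesis by simp
qed

lemma is_pole_assoc_fun_iff:
  assumes "even_part p \<noteq> 0"
  shows "is_pole (assoc_fun p) u \<longleftrightarrow>
    is_pole (\<lambda>u. poly (cpoly (odd_part p)) u / poly (cpoly (even_part p)) u) u"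
  unfolding assoc_fun_def by (rule is_pole_remove_sings_iff) (use assms in \<open>auto intro: rational_isolated\<close>)

lemma assoc_fun_eq:
  assumes "poly (cpoly (even_part p)) u \<noteq> 0"
  shows "assoc_fun p u = poly (cpoly (odd_part p)) u / poly (cpoly (even_part p)) u"
  unfolding assoc_fun_def using assms by (rule rational_not_pole)

lemma assoc_fun_even_part_0:
  assumes "even_part p = 0"
  shows "assoc_fun p = (\<lambda>_. 0)"
  unfolding assoc_fun_def by (simp add: assms fun_eq_iff)

section \<open>Counting real zeros by signs\<close>

text \<open>
  By the intermediate value theorem the polynomial keeps the sign it has near \<open>+\<infinity>\<close>.
\<close>

lemma no_real_roots_sgn:
  fixes q :: "real poly"
  assumes "\<And>x. poly q x \<noteq> 0"
  shows "sgn (poly q x) = sgn (lead_coeff q)"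
proof -
  have pos: "poly q x > 0" if "lead_coeff q > 0" and nz: "\<And>x. poly q x \<noteq> 0" for q :: "real poly" and x
  proof (rule ccontr)
    assume "\<not> poly q x > 0"
    then have "poly q x < 0" using nz[of x] by linarith
    moreover obtain N where "\<forall>y\<ge>N. poly q y \<ge> lead_coeff q"
      using poly_pinfty_gt_lc[OF \<open>lead_coeff q > 0\<close>] by blast
    then have "poly q (max N (x + 1)) > 0"
      using \<open>lead_coeff q > 0\<close> by (meson less_le_trans max.cobounded1)
    ultimately show False
      using poly_IVT_pos[of x "max N (x + 1)" q] nz by fastforce
  qed
  have "q \<noteq> 0" using assms[of 0] by auto
  then consider "lead_coeff q > 0" | "lead_coeff (- q) > 0"
    by (metis lead_coeff_minus leading_coeff_0_iff neg_0_less_iff_less linorder_neqE_linordered_idom)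
  then show ?thesis
  proof cases
    case 1
    then show ?thesis using pos[OF 1 assms, of x] by simp
  next
    case 2
    then have "poly (- q) x > 0" by (rule pos) (use assms in simp)
    then show ?thesis using 2 by simp
  qed
qed

text \<open>
  The signs at \<open>+\<infinity>\<close> and at \<open>-\<infinity>\<close> agree; the latter is read off from the reflected polynomial \<open>q(-x)\<close>.
\<close>

lemma no_real_roots_even_degree:
  fixes q :: "real poly"
  assumes "\<And>x. poly q x \<noteq> 0"
  shows "even (degree q)"
proof -
  let ?r = "pcompose q [:0, -1:]"
  have "sgn (poly ?r 0) = sgn (lead_coeff ?r)"
    by (rule no_real_roots_sgn) (simp add: poly_pcompose assms)
  moreover have "lead_coeff ?r = lead_coeff q * (- 1) ^ degree q"
    by (subst lead_coeff_comp) auto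
  moreover have "sgn (poly q 0) = sgn (lead_coeff q)"
    by (rule no_real_roots_sgn) (rule assms)
  moreover have "lead_coeff q \<noteq> 0" using assms[of 0] by auto
  ultimately show ?thesis
    by (cases "even (degree q)") (auto simp: poly_pcompose sgn_mult sgn_if split: if_splits)
qed

lemma zeros_on_linear_factor:
  assumes "p \<noteq> 0"
  shows "zeros_on ([:- a, 1:] * p) I = of_bool (a \<in> I) + zeros_on p I"
  using assms by (subst zeros_on_def, subst proots_mult) (auto simp: zeros_on_def)

text \<open>
  Removing real linear factors one at a time reduces statements about real zeros to polynomials
  without any.
\<close>

lemma real_root_induct [consumes 1, case_names no_roots root]:
  fixes p :: "real poly"
  assumes "p \<noteq> 0"
    and "\<And>q. (\<And>x. poly q x \<noteq> 0) \<Longrightarrow> P q"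
    and "\<And>a q. q \<noteq> 0 \<Longrightarrow> P q \<Longrightarrow> P ([:- a, 1:] * q)"
  shows "P p"
  using assms(1)
proof (induction "degree p" arbitrary: p rule: less_induct)
  case less
  show ?case
  proof (cases "\<exists>a. poly p a = 0")
    case True
    then obtain a q where q: "p = [:- a, 1:] * q"
      by (metis dvdE poly_eq_0_iff_dvd)
    with less.prems have "q \<noteq> 0" by auto
    moreover from this have "degree q < degree p"
      unfolding q by (subst degree_mult_eq) auto
    ultimately show ?thesis using less.hyps[of q] assms(3)[of q a] q by blast
  next
    case False
    then show ?thesis by (intro assms(2)) auto
  qed
qed

lemma lead_coeff_linear_factor: "lead_coeff ([:- a, 1:] * q) = lead_coeff (q :: real poly)"
  by (subst lead_coeff_mult) simp

text \<open>
  Each real zero to the right of \<open>x\<close> contributes one factor of negative sign. This turns parities of numbers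
  of zeros into signs and back, which is how the interval conditions in the definition of generalized
  Hurwitz polynomials are used throughout.
\<close>

lemma sgn_poly_eq:
  fixes p :: "real poly"
  assumes "poly p x \<noteq> 0"
  shows "sgn (poly p x) = (- 1) ^ zeros_on p {x<..} * sgn (lead_coeff p)"
proof -
  have "p \<noteq> 0" using assms by auto
  then show ?thesis using assms
  proof (induction p rule: real_root_induct)
    case (no_roots q)
    then have "proots q = {#}"
      by (metis count_proots multi_count_eq count_empty order_0I poly_0 zero_multiset.rep_eq
          multiset_eqI)
    then show ?case using no_real_roots_sgn[of q x] no_roots by (simp add: zeros_on_def)
  next
    case (root a q)
    have eq: "poly ([:- a, 1:] * q) x = (x - a) * poly q x" by (simp add: algebra_simps)
    with root have nz: "poly q x \<noteq> 0" "x \<noteq> a" by auto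
    show ?case
      unfolding eq zeros_on_linear_factor[OF root(1)] lead_coeff_linear_factor sgn_mult
        root(2)[OF nz(1)]
      using nz(2) by (auto simp: sgn_if)
  qed
qed

text \<open>
  Nonreal zeros come in conjugate pairs; here they are the factor without real zeros. The lemma
  explains why the parity demanded on the unbounded interval \<open>(-\<infinity>, -\<mu>\<^sub>k)\<close> depends on that of the degree.
\<close>

lemma even_degree_plus_zeros:
  fixes p :: "real poly"
  assumes "p \<noteq> 0"
  shows "even (degree p + zeros_on p UNIV)"
  using assms
proof (induction p rule: real_root_induct)
  case (no_roots q)
  then have "proots q = {#}"
    by (metis count_proots multi_count_eq count_empty order_0I poly_0 zero_multiset.rep_eq
        multiset_eqI)
  then show ?case using no_real_roots_even_degree[of q] no_roots by (simp add: zeros_on_def)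
next
  case (root a q)
  have "degree ([:- a, 1:] * q) = 1 + degree q"
    using root(1) by (subst degree_mult_eq) auto
  then show ?case
    using root by (simp add: zeros_on_linear_factor del: mult_pCons_left)
qed

lemma zeros_on_cong:
  assumes "p \<noteq> 0" "\<And>x. poly p x = 0 \<Longrightarrow> x \<in> I \<longleftrightarrow> x \<in> J"
  shows "zeros_on p I = zeros_on p J"
  unfolding zeros_on_def using assms by (intro arg_cong[of _ _ size] filter_mset_cong) auto

lemma zeros_on_Un:
  assumes "I \<inter> J = {}"
  shows "zeros_on p (I \<union> J) = zeros_on p I + zeros_on p J"
proof -
  have "{#x \<in># proots p. x \<in> I \<union> J#} = {#x \<in># proots p. x \<in> I#} + {#x \<in># proots p. x \<in> J#}"
    using assms by (intro multiset_eqI) auto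
  then show ?thesis by (simp add: zeros_on_def)
qed

lemma zeros_on_simple:
  assumes "p \<noteq> 0" "\<And>x. x \<in> I \<Longrightarrow> poly p x = 0 \<Longrightarrow> order x p = 1"
  shows "zeros_on p I = card {x \<in> I. poly p x = 0}"
proof -
  have "zeros_on p I = (\<Sum>x\<in>{x \<in> I. poly p x = 0}. count {#x \<in># proots p. x \<in> I#} x)"
    unfolding zeros_on_def size_multiset_overloaded_eq using assms(1)
    by (intro sum.cong) auto
  also have "\<dots> = (\<Sum>x\<in>{x \<in> I. poly p x = 0}. 1)"
    by (intro sum.cong) (use assms in auto)
  finally show ?thesis by simp
qed

lemma zeros_on_pos_iff:
  assumes "p \<noteq> 0"
  shows "zeros_on p I > 0 \<longleftrightarrow> (\<exists>x\<in>I. poly p x = 0)"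
  using assms by (auto simp: zeros_on_def simp flip: nonempty_has_size set_mset_eq_empty_iff)

lemma simple_root_iff_pderiv:
  fixes p :: "'a :: field poly"
  assumes "p \<noteq> 0" "poly p a = 0"
  shows "order a p = 1 \<longleftrightarrow> poly (pderiv p) a \<noteq> 0"
proof -
  obtain q where q: "p = [:- a, 1:] * q" using assms(2) by (metis dvdE poly_eq_0_iff_dvd)
  have "poly (pderiv p) a = poly q a"
    unfolding q pderiv_mult by (simp add: pderiv_pCons)
  moreover have "order a p = order a [:- a, 1:] + order a q"
    using assms(1) unfolding q by (rule order_mult)
  moreover have "order a [:- a, 1:] = 1"
    using order_power_n_n[of a 1] by simp
  moreover have "q \<noteq> 0" using assms(1) q by auto
  ultimately show ?thesis by (simp add: order_root)
qed

text \<open>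
  At a simple zero \<open>a\<close> the derivative is the value of the cofactor of \<open>x - a\<close>, and that cofactor has the
  same zeros to the right of \<open>a\<close>.
\<close>

lemma sgn_pderiv_simple_root:
  fixes p :: "real poly"
  assumes "p \<noteq> 0" "poly p a = 0" "order a p = 1"
  shows "sgn (poly (pderiv p) a) = (- 1) ^ zeros_on p {a<..} * sgn (lead_coeff p)"
proof -
  obtain q where q: "p = [:- a, 1:] * q" using assms(2) by (metis dvdE poly_eq_0_iff_dvd)
  have nz: "q \<noteq> 0" using assms(1) q by auto
  have "poly (pderiv p) a = poly q a"
    unfolding q pderiv_mult by (simp add: pderiv_pCons)
  moreover have "poly (pderiv p) a \<noteq> 0" using assms simple_root_iff_pderiv by blast
  ultimately show ?thesis
    using sgn_poly_eq[of q a] unfolding q lead_coeff_linear_factor zeros_on_linear_factor[OF nz]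
    by simp
qed

section \<open>Polynomials whose associated function decreases\<close>

lemma strict_mono_enumeration:
  fixes S :: "'a :: linorder set"
  assumes "finite S"
  obtains \<mu> :: "nat \<Rightarrow> 'a" where "strict_mono_on {1..card S} \<mu>" "\<mu> ` {1..card S} = S"
proof -
  let ?l = "sorted_list_of_set S" and ?\<mu> = "\<lambda>i. sorted_list_of_set S ! (i - 1)"
  have len: "length ?l = card S" by simp
  have "strict_mono_on {1..card S} ?\<mu>"
    using strict_sorted_list_of_set[of S] len
    by (intro strict_mono_onI) (auto simp: sorted_wrt_iff_nth_less)
  moreover have "(\<lambda>i. i - 1) ` {1..card S} = {..<card S}"
    by (auto simp: image_iff intro!: bexI[of _ "Suc _"])
  then have "?\<mu> ` {1..card S} = (!) ?l ` {..<length ?l}"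
    by (metis image_image len)
  then have "?\<mu> ` {1..card S} = set ?l" by (auto simp: set_conv_nth)
  then have "?\<mu> ` {1..card S} = S" using assms by simp
  ultimately show ?thesis by (rule that)
qed

lemma zeros_on_atLeast_split:
  assumes "a < b"
  shows "zeros_on p {a..} = zeros_on p {a} + zeros_on p {a<..<b} + zeros_on p {b..}"
proof -
  have "{a..} = ({a} \<union> {a<..<b}) \<union> {b..}" using assms by auto
  also have "zeros_on p \<dots> = zeros_on p ({a} \<union> {a<..<b}) + zeros_on p {b..}"
    by (rule zeros_on_Un) (use assms in auto)
  also have "zeros_on p ({a} \<union> {a<..<b}) = zeros_on p {a} + zeros_on p {a<..<b}"
    by (rule zeros_on_Un) auto
  finally show ?thesis .
qed

lemma zeros_on_singleton_0: "p \<noteq> 0 \<Longrightarrow> poly p a \<noteq> 0 \<Longrightarrow> zeros_on p {a} = 0"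
  using zeros_on_pos_iff[of p "{a}"] by auto

text \<open>
  The function \<open>p(z)/e(z\<^sup>2) = 1 + z \<Phi>(z\<^sup>2)\<close> vanishes at \<open>x\<close>, and its derivative there is
  \<open>\<Phi>(x\<^sup>2) + 2x\<^sup>2 \<Phi>'(x\<^sup>2)\<close>, where \<open>\<Phi>(x\<^sup>2) = -1/x < 0\<close> and \<open>\<Phi>'(x\<^sup>2) \<le> 0\<close>. So \<open>p'(x)\<close> and \<open>e(x\<^sup>2)\<close> have opposite signs,
  and \<open>p(-x) = 2 e(x\<^sup>2)\<close>. The hypothesis on the Wronskian is \<open>\<Phi>' \<le> 0\<close> with denominators cleared.
\<close>

lemma decreasing_quotient_sign:
  assumes x: "x > 0" "poly p x = 0"
    and nc: "\<not> (poly (even_part p) (x\<^sup>2) = 0 \<and> poly (odd_part p) (x\<^sup>2) = 0)"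
    and W: "poly (even_part p * pderiv (odd_part p) - pderiv (even_part p) * odd_part p) (x\<^sup>2) \<le> 0"
  shows "poly p (- x) * poly (pderiv p) x < 0"
proof -
  let ?e = "poly (even_part p) (x\<^sup>2)" and ?o = "poly (odd_part p) (x\<^sup>2)"
  let ?e' = "poly (pderiv (even_part p)) (x\<^sup>2)" and ?o' = "poly (pderiv (odd_part p)) (x\<^sup>2)"
  have root: "?e = - x * ?o" using poly_even_odd[of p x] x by simp
  then have o: "?o \<noteq> 0" using nc by auto
  have "pderiv p = pderiv (pcompose (even_part p) (monom 1 2) + monom 1 1 * pcompose (odd_part p) (monom 1 2))"
    by (subst even_odd_decomposition) (rule refl)
  also have "poly \<dots> x = 2 * x * ?e' + ?o + 2 * x\<^sup>2 * ?o'"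
    by (simp add: pderiv_add pderiv_mult pderiv_pcompose poly_pcompose poly_monom pderiv_monom
        power2_eq_square algebra_simps)
  finally have dp: "poly (pderiv p) x = 2 * x * ?e' + ?o + 2 * x\<^sup>2 * ?o'" .
  have "poly p (- x) = 2 * ?e" using poly_even_odd[of p "- x"] root by simp
  then have "poly p (- x) * poly (pderiv p) x = 2 * (?e * ?o + 2 * (x\<^sup>2 * (?e * ?o' - ?e' * ?o)))"
    unfolding dp using root by (simp add: power2_eq_square algebra_simps)
  also have "\<dots> < 0"
  proof -
    have "?e * ?o = - (x * ?o\<^sup>2)" using root by (simp add: power2_eq_square)
    then have "?e * ?o < 0" using x o by simp
    moreover have "x\<^sup>2 * (?e * ?o' - ?e' * ?o) \<le> 0"
      using W x by (intro mult_nonneg_nonpos) auto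
    moreover have "2 * (a + 2 * b) < 0" if "a < 0" "b \<le> 0" for a b :: real
      using that by simp
    ultimately show ?thesis by blast
  qed
  finally show ?thesis .
qed

text \<open>
  All the sign conditions of the definition follow from one parity: for every \<open>i\<close> the number of zeros in
  \<open>[-\<mu>\<^sub>i, \<infinity>)\<close> is even exactly when \<open>k - i\<close> is odd. For \<open>\<mu>\<^sub>i > 0\<close> this combines
  \<open>decreasing_quotient_sign\<close> with the sign \<open>(-1)\<^bsup>k - i\<^esup>\<close> of \<open>p'(\<mu>\<^sub>i)\<close>; for \<open>\<mu>\<^sub>i = 0\<close> it is a direct
  count. Differences of consecutive parities give the bounded intervals, and the parity of the
  degree gives the unbounded one.
\<close>

lemma generalized_hurwitzI:
  fixes p :: "real poly"
  assumes lead: "lead_coeff p > 0"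
    and nr: "\<And>z. poly (cpoly p) z = 0 \<Longrightarrow> Re z \<ge> 0 \<Longrightarrow> z \<in> \<real>"
    and nc: "\<And>x. x \<ge> 0 \<Longrightarrow> \<not> (poly (even_part p) x = 0 \<and> poly (odd_part p) x = 0)"
    and W: "\<And>x. x > 0 \<Longrightarrow>
      poly (even_part p * pderiv (odd_part p) - pderiv (even_part p) * odd_part p) x \<le> 0"
  shows "generalized_hurwitz p"
proof -
  have p0: "p \<noteq> 0" using lead by auto
  define S where "S = {x. x \<ge> 0 \<and> poly p x = 0}"
  have fin: "finite S" unfolding S_def using poly_roots_finite[OF p0] by simp
  define k where "k = card S"
  obtain \<mu> where mono: "strict_mono_on {1..k} \<mu>" and img: "\<mu> ` {1..k} = S"
    using strict_mono_enumeration[OF fin] unfolding k_def by blast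
  have less_iff: "\<mu> i < \<mu> j \<longleftrightarrow> i < j" if "i \<in> {1..k}" "j \<in> {1..k}" for i j
    using mono that strict_mono_on_less by blast
  have inS: "\<mu> i \<in> S" if "i \<in> {1..k}" for i using img that by blast
  have nonneg: "\<mu> i \<ge> 0" and root: "poly p (\<mu> i) = 0" if "i \<in> {1..k}" for i
    using inS[OF that] by (auto simp: S_def)
  have key: "poly p (- x) * poly (pderiv p) x < 0" if "x > 0" "poly p x = 0" for x
    using that by (intro decreasing_quotient_sign nc W) auto
  have simple: "order x p = 1" if "x \<in> S" for x
  proof (cases "x = 0")
    case True
    have "poly (even_part p) 0 = 0" using that True by (simp add: S_def poly_even_odd[of p 0])
    then have "coeff p 1 \<noteq> 0"
      using nc[of 0] by (simp add: poly_0_coeff_0 coeff_odd_part)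
    then have "poly (pderiv p) 0 \<noteq> 0" by (simp add: poly_0_coeff_0 coeff_pderiv)
    then show ?thesis using simple_root_iff_pderiv[OF p0] that True by (auto simp: S_def)
  next
    case False
    then have "poly (pderiv p) x \<noteq> 0" using key[of x] that by (auto simp: S_def)
    then show ?thesis using simple_root_iff_pderiv[OF p0] that by (auto simp: S_def)
  qed
  have neg: "poly p (- \<mu> i) \<noteq> 0" if "i \<in> {1..k}" "\<mu> i > 0" for i
    using key[of "\<mu> i"] root[OF that(1)] that by auto
  have right: "zeros_on p {\<mu> i<..} = k - i" if i: "i \<in> {1..k}" for i
  proof -
    have "zeros_on p {\<mu> i<..} = card {x \<in> {\<mu> i<..}. poly p x = 0}"
      by (intro zeros_on_simple p0 simple) (use nonneg[OF i] in \<open>auto simp: S_def\<close>)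
    also have "{x \<in> {\<mu> i<..}. poly p x = 0} = {x \<in> S. x > \<mu> i}"
      using nonneg[OF i] by (auto simp: S_def)
    also have "\<dots> = \<mu> ` {i<..k}"
      using i less_iff by (force simp: img[symmetric])
    also have "card \<dots> = card {i<..k}"
      by (intro card_image inj_on_subset[OF strict_mono_on_imp_inj_on[OF mono]]) (use i in auto)
    finally show ?thesis by simp
  qed
  have all: "zeros_on p {0..} = k"
  proof -
    have "zeros_on p {0..} = card {x \<in> {0..}. poly p x = 0}"
      by (intro zeros_on_simple p0 simple) (auto simp: S_def)
    then show ?thesis by (simp add: k_def S_def)
  qed
  have first: "i = 1" if "i \<in> {1..k}" "\<mu> i = 0" for i
  proof (rule ccontr)
    assume "i \<noteq> 1"
    then have "\<mu> 1 < \<mu> i" using that less_iff[of 1 i] by auto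
    then show False using nonneg[of 1] that by auto
  qed
  have par: "even (zeros_on p {- \<mu> i..}) \<longleftrightarrow> odd (k - i)" if i: "i \<in> {1..k}" for i
  proof (cases "\<mu> i = 0")
    case True
    then show ?thesis using first[OF i] all i by auto
  next
    case False
    then have pos: "\<mu> i > 0" using nonneg[OF i] by simp
    have "sgn (poly (pderiv p) (\<mu> i)) = (- 1) ^ (k - i)"
      using sgn_pderiv_simple_root[OF p0 root[OF i] simple[OF inS[OF i]]] right[OF i] lead by simp
    moreover have "sgn (poly p (- \<mu> i)) = (- 1) ^ zeros_on p {- \<mu> i<..}"
      using sgn_poly_eq[of p "- \<mu> i"] neg[OF i pos] lead by simp
    moreover have "sgn (poly p (- \<mu> i)) * sgn (poly (pderiv p) (\<mu> i)) = - 1"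
      using key[OF pos root[OF i]] by (simp flip: sgn_mult)
    moreover have "zeros_on p {- \<mu> i<..} = zeros_on p {- \<mu> i..}"
      using neg[OF i pos] by (intro zeros_on_cong p0) (auto simp: order_less_le)
    ultimately have "(- 1 :: real) ^ (zeros_on p {- \<mu> i..} + (k - i)) = - 1"
      by (simp add: power_add)
    then show ?thesis by (cases "even (zeros_on p {- \<mu> i..} + (k - i))") auto
  qed
  have step: "zeros_on p {- \<mu> (i + 1)..} = zeros_on p {- \<mu> (i + 1)<..<- \<mu> i} + zeros_on p {- \<mu> i..}"
    if "i \<in> {1..<k}" for i
  proof -
    have "\<mu> i < \<mu> (i + 1)" using less_iff[of i "i + 1"] that by auto
    moreover from this have "\<mu> (i + 1) > 0" using nonneg[of i] that by auto
    ultimately show ?thesis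
      using zeros_on_atLeast_split[of "- \<mu> (i + 1)" "- \<mu> i" p] neg[of "i + 1"] that p0
      by (simp add: zeros_on_singleton_0)
  qed
  have iii: "odd (zeros_on p {- \<mu> (i + 1)<..<- \<mu> i})" if "i \<in> {1..<k}" for i
  proof -
    have *: "even (zeros_on p {- \<mu> (i + 1)..}) \<longleftrightarrow> odd (k - (i + 1))"
      "even (zeros_on p {- \<mu> i..}) \<longleftrightarrow> odd (k - i)"
      using that by (intro par; simp)+
    have "k - i = Suc (k - (i + 1))" using that by auto
    then show ?thesis using * unfolding step[OF that] by auto
  qed
  have iv: "even (zeros_on p {- \<mu> 1<..<0})" if "k \<ge> 1"
  proof (cases "\<mu> 1 = 0")
    case False
    then have pos: "\<mu> 1 > 0" using nonneg[of 1] that by simp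
    have "zeros_on p {- \<mu> 1..} = zeros_on p {- \<mu> 1<..<0} + k"
      using zeros_on_atLeast_split[of "- \<mu> 1" 0 p] neg[of 1] pos that p0 all
      by (simp add: zeros_on_singleton_0)
    then show ?thesis using par[of 1] that by auto
  qed (simp add: zeros_on_def)
  have v: "even (degree p) \<longleftrightarrow> odd (zeros_on p {..<- \<mu> k})" if "k \<ge> 1"
  proof -
    have "UNIV = {..<- \<mu> k} \<union> {- \<mu> k..}" by auto
    then have "zeros_on p UNIV = zeros_on p {..<- \<mu> k} + zeros_on p {- \<mu> k..}"
      by (metis zeros_on_Un disjoint_iff atLeast_iff lessThan_iff not_le)
    then show ?thesis using even_degree_plus_zeros[OF p0] par[of k] that by auto
  qed
  \<comment> \<open>The \<open>k\<close> nonnegative zeros and at least one zero in each interval between reflected points.\<close>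
  have bound: "k + i \<le> zeros_on p {- \<mu> i..} + 1" if "i \<in> {1..k}" for i
    using that
  proof (induction i)
    case (Suc i)
    show ?case
    proof (cases "i = 0")
      case True
      have "{- \<mu> 1..} = {- \<mu> 1..<0} \<union> {0..}" using nonneg[of 1] Suc.prems True by auto
      then have "zeros_on p {- \<mu> 1..} = zeros_on p {- \<mu> 1..<0} + zeros_on p {0..}"
        by (simp only:) (rule zeros_on_Un, auto)
      then show ?thesis using True all by simp
    next
      case False
      then have "i \<in> {1..<k}" using Suc.prems by auto
      then show ?thesis using Suc.IH step[of i] iii[of i] odd_pos by fastforce
    qed
  qed simp
  have kbound: "k \<le> (degree p + 1) div 2"
  proof (cases "k = 0")
    case False
    have "zeros_on p {- \<mu> k..} \<le> size (proots p)"
      unfolding zeros_on_def by (rule size_filter_mset_lesseq)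
    also have "\<dots> \<le> degree p" by (rule size_proots_le)
    finally show ?thesis using bound[of k] False by auto
  qed simp
  have i: "{z. poly (cpoly p) z = 0 \<and> Re z \<ge> 0} = (\<lambda>i. complex_of_real (\<mu> i)) ` {1..k}"
  proof -
    have "{z. poly (cpoly p) z = 0 \<and> Re z \<ge> 0} = complex_of_real ` S"
    proof (intro equalityI subsetI)
      fix z assume z: "z \<in> {z. poly (cpoly p) z = 0 \<and> Re z \<ge> 0}"
      then obtain x where "z = of_real x" using nr[of z] by (auto elim: Reals_cases)
      then show "z \<in> complex_of_real ` S" using z by (auto simp: S_def)
    qed (auto simp: S_def)
    then show ?thesis by (simp add: img[symmetric] image_image)
  qed
  \<comment> \<open>A zero outside all the listed intervals would lie to the left of every reflected point.\<close>
  have loc: "x \<in> \<mu> ` {1..k} \<union> (\<Union>i\<in>{1..<k}. {- \<mu> (i + 1)<..<- \<mu> i}) \<union> {- \<mu> 1<..<0} \<union> {..<- \<mu> k}"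
    if k: "k \<ge> 1" and x: "poly p x = 0" for x
  proof (rule ccontr)
    assume nin: "\<not> ?thesis"
    have "x \<notin> \<mu> ` {1..k}" using nin by blast
    then have neg_x: "x < 0" using x unfolding img S_def by simp
    have ne: "x \<noteq> - \<mu> i" if "i \<in> {1..k}" for i
      using neg[OF that] x nonneg[OF that] neg_x by force
    have "- \<mu> i > x" if "i \<in> {1..k}" for i
      using that
    proof (induction i)
      case (Suc i)
      show ?case
      proof (cases "i = 0")
        case True
        then show ?thesis using nin neg_x ne[of 1] k by auto
      next
        case False
        then have "i \<in> {1..<k}" using Suc.prems by auto
        then show ?thesis using Suc nin ne[of "Suc i"] by force
      qed
    qed simp
    then show False using nin k by auto
  qed
  have vi: "Re z < 0" if "poly (cpoly p) z = 0" "z \<notin> \<real>" for z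
    using nr[of z] that by force
  have "gen_hurwitz_order p k"
    unfolding gen_hurwitz_order_def
  proof (intro conjI exI[of _ \<mu>])
    show "k \<ge> 1 \<longrightarrow> even (zeros_on p {- \<mu> 1<..<0}) \<and>
      (\<forall>x. poly p x = 0 \<longrightarrow> x \<in> \<mu> ` {1..k} \<union> (\<Union>i\<in>{1..<k}. {- \<mu> (i + 1)<..<- \<mu> i}) \<union>
         {- \<mu> 1<..<0} \<union> {..<- \<mu> k}) \<and>
      (if even (degree p) then odd (zeros_on p {..<- \<mu> k}) else even (zeros_on p {..<- \<mu> k}))"
      using iv v loc by presburger
  qed (use lead kbound mono i simple inS nonneg neg iii vi in auto)
  then show ?thesis unfolding generalized_hurwitz_def by blast
qed

section \<open>Boundary behaviour of R-functions\<close>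

text \<open>
  This is the defining inequality multiplied by \<open>|e(z)|\<^sup>2\<close>. In this form it needs no case distinction
  at poles and cancelled zeros and passes to limits.
\<close>

lemma R_function_Im:
  assumes "even_part p \<noteq> 0" "R_function (assoc_fun p)" "Im z > 0"
  shows "Im (poly (cpoly (odd_part p)) z * cnj (poly (cpoly (even_part p)) z)) \<le> 0"
proof (cases "poly (cpoly (even_part p)) z = 0")
  case False
  have "Im (assoc_fun p z) < 0" using assms(2,3) by (auto simp: R_function_def)
  then have "Im (poly (cpoly (odd_part p)) z * cnj (poly (cpoly (even_part p)) z) /
      of_real ((cmod (poly (cpoly (even_part p)) z))\<^sup>2)) < 0"
    unfolding assoc_fun_eq[OF False] by (subst (asm) complex_div_cnj) simp
  then show ?thesis using False
    by (subst (asm) Im_divide_of_real) (simp add: divide_less_0_iff)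
qed simp

text \<open>
  On the line \<open>x + it\<close> the function \<open>P(x + it) Q(x - it)\<close> has imaginary part at most \<open>0\<close> for \<open>t > 0\<close> and equal to
  \<open>0\<close> at \<open>t = 0\<close>, so its derivative at \<open>0\<close>, which is \<open>i\<close> times the Wronskian, has nonpositive imaginary part.
\<close>

lemma wronskian_nonpos:
  fixes P Q :: "real poly"
  assumes im: "\<And>z. Im z > 0 \<Longrightarrow> Im (poly (cpoly P) z * cnj (poly (cpoly Q) z)) \<le> 0"
  shows "poly (Q * pderiv P - pderiv Q * P) x \<le> 0"
proof -
  define G where "G = (\<lambda>w. poly (cpoly P) (of_real x + \<i> * w) * poly (cpoly Q) (of_real x - \<i> * w))"
  let ?W = "poly (Q * pderiv P - pderiv Q * P) x"
  have "(G has_field_derivative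
      poly (pderiv (cpoly P)) (of_real x + \<i> * 0) * \<i> * poly (cpoly Q) (of_real x - \<i> * 0) +
      (poly (pderiv (cpoly Q)) (of_real x - \<i> * 0) * (- \<i>)) * poly (cpoly P) (of_real x + \<i> * 0)) (at 0)"
    unfolding G_def by (rule derivative_eq_intros refl | simp)+
  also have "poly (pderiv (cpoly P)) (of_real x + \<i> * 0) * \<i> * poly (cpoly Q) (of_real x - \<i> * 0) +
      (poly (pderiv (cpoly Q)) (of_real x - \<i> * 0) * (- \<i>)) * poly (cpoly P) (of_real x + \<i> * 0) =
      \<i> * of_real ?W"
    by (simp add: cpoly_pderiv algebra_simps)
  finally have "((\<lambda>w. (G w - G 0) / (w - 0)) \<longlongrightarrow> \<i> * of_real ?W) (at 0)"
    by (simp add: has_field_derivative_iff)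
  moreover have "filterlim complex_of_real (at 0) (at_right 0)"
    by (auto simp: filterlim_at eventually_at_filter intro!: tendsto_eq_intros)
  ultimately have "((\<lambda>t. (G (of_real t) - G 0) / (of_real t - 0)) \<longlongrightarrow> \<i> * of_real ?W) (at_right 0)"
    by (rule filterlim_compose)
  then have lim: "((\<lambda>t. Im ((G (of_real t) - G 0) / of_real t)) \<longlongrightarrow> ?W) (at_right 0)"
    by (auto dest: tendsto_Im)
  have "Im ((G (of_real t) - G 0) / of_real t) \<le> 0" if "t > 0" for t
  proof -
    have "cnj (of_real x + \<i> * of_real t) = of_real x - \<i> * of_real t" by simp
    then have "G (of_real t) = poly (cpoly P) (of_real x + \<i> * of_real t) *
        cnj (poly (cpoly Q) (of_real x + \<i> * of_real t))"
      unfolding G_def by (metis poly_cpoly_cnj)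
    then have "Im (G (of_real t)) \<le> 0" using im[of "of_real x + \<i> * of_real t"] that by simp
    moreover have "Im (G 0) = 0" by (simp add: G_def)
    ultimately show ?thesis using that by (simp add: divide_le_0_iff)
  qed
  then have "eventually (\<lambda>t. Im ((G (of_real t) - G 0) / of_real t) \<le> 0) (at_right 0)"
    by (auto simp: eventually_at_filter)
  with lim show ?thesis by (intro tendsto_upperbound[OF lim]) auto
qed

lemma card_roots_eq_degree_iff:
  fixes q :: "complex poly"
  assumes "q \<noteq> 0"
  shows "card {x. poly q x = 0} = degree q \<longleftrightarrow> (\<forall>x. poly q x = 0 \<longrightarrow> order x q = 1)"
proof -
  let ?R = "{x. poly q x = 0}"
  have fin: "finite ?R" using assms by (rule poly_roots_finite)
  have deg: "degree q = (\<Sum>x\<in>?R. order x q)"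
    unfolding size_proots_complex[symmetric] size_multiset_overloaded_eq using assms by simp
  have pos: "order x q \<ge> 1" if "x \<in> ?R" for x
    using that assms order_root[of q x] by (simp add: Suc_le_eq)
  show ?thesis
  proof
    assume card: "card ?R = degree q"
    show "\<forall>x. poly q x = 0 \<longrightarrow> order x q = 1"
    proof (rule ccontr)
      assume "\<not> ?thesis"
      then obtain y where "y \<in> ?R" "order y q \<noteq> 1" by auto
      then have "\<exists>y\<in>?R. 1 < order y q" using pos by (intro bexI[of _ y]) force+
      then have "(\<Sum>x\<in>?R. 1) < (\<Sum>x\<in>?R. order x q)"
        by (intro sum_strict_mono_ex1 fin) (use pos in auto)
      then show False using card deg by simp
    qed
  qed (simp add: deg)
qed

text \<open>
  Poles are zeros of \<open>e\<close>, of which there are at most \<open>deg e\<close>. If all of these are used up by poles, every zero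
  of \<open>e\<close> is simple and a pole, so it is not cancelled by \<open>f\<close>; it does not lie in the upper half-plane, and
  neither does its conjugate.
\<close>

lemma maximal_poles_imp_real_coprime:
  assumes R: "R_function (assoc_fun p)" and card: "degree (even_part p) \<le> num_poles (assoc_fun p)"
    and nz: "even_part p \<noteq> 0" and root: "poly (cpoly (even_part p)) u = 0"
  shows "u \<in> \<real>" "poly (cpoly (odd_part p)) u \<noteq> 0"
proof -
  let ?Q = "cpoly (even_part p)"
  have Q0: "?Q \<noteq> 0" using nz by simp
  have sub: "{u. is_pole (assoc_fun p) u} \<subseteq> {u. poly ?Q u = 0}"
    using is_pole_assoc_fun_iff[OF nz] rational_not_pole(1) by blast
  have fin: "finite {u. poly ?Q u = 0}" using Q0 by (rule poly_roots_finite)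
  have le: "card {u. poly ?Q u = 0} \<le> degree ?Q" using Q0 by (rule card_poly_roots_bound)
  moreover have "card {u. is_pole (assoc_fun p) u} \<le> card {u. poly ?Q u = 0}"
    using fin sub by (rule card_mono)
  ultimately have eq: "card {u. is_pole (assoc_fun p) u} = card {u. poly ?Q u = 0}"
    and simple: "card {u. poly ?Q u = 0} = degree ?Q"
    using card by (simp_all add: num_poles_def)
  have pole: "is_pole (assoc_fun p) u" if "poly ?Q u = 0" for u
    using card_subset_eq[OF fin sub eq] that by blast
  have "order u ?Q = 1" using simple root card_roots_eq_degree_iff[OF Q0] by blast
  then show "poly (cpoly (odd_part p)) u \<noteq> 0"
    using pole[OF root] rational_simple_root_not_pole[OF _ Q0] is_pole_assoc_fun_iff[OF nz] by blast
  have "\<not> Im u > 0" using pole[OF root] R by (auto simp: R_function_def)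
  moreover have "\<not> Im (cnj u) > 0" using pole[of "cnj u"] root R by (auto simp: R_function_def)
  ultimately show "u \<in> \<real>" by (simp add: complex_is_Real_iff)
qed

text \<open>
  Dividing by the top power turns \<open>p\<close> into its reflected polynomial at the inverse argument, which
  tends to \<open>0\<close>.
\<close>

lemma cpoly_ray_at_top:
  fixes P :: "real poly" and w :: complex
  assumes "w \<noteq> 0"
  shows "((\<lambda>t. poly (cpoly P) (of_real t * w) / of_real t ^ degree P) \<longlongrightarrow>
    of_real (lead_coeff P) * w ^ degree P) at_top"
proof -
  have "filterlim (\<lambda>t. w * of_real t) at_infinity at_top"
    by (intro tendsto_mult_filterlim_at_infinity[OF tendsto_const assms] filterlim_of_real_at_infinity)
  then have inf: "filterlim (\<lambda>t. of_real t * w) at_infinity at_top"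
    by (simp add: mult.commute)
  have "((\<lambda>t. poly (reflect_poly (cpoly P)) (inverse (of_real t * w)) * w ^ degree P) \<longlongrightarrow>
      poly (reflect_poly (cpoly P)) 0 * w ^ degree P) at_top"
  proof (intro tendsto_intros)
    show "((\<lambda>t. inverse (complex_of_real t * w)) \<longlongrightarrow> 0) at_top"
      by (rule filterlim_compose[OF tendsto_inverse_0]) (fact inf)
  qed
  moreover have "eventually (\<lambda>t. poly (reflect_poly (cpoly P)) (inverse (of_real t * w)) * w ^ degree P =
      poly (cpoly P) (of_real t * w) / of_real t ^ degree P) at_top"
    using eventually_gt_at_top[of 0]
  proof eventually_elim
    case (elim t)
    then show ?case using assms
      by (subst poly_reflect_poly_nz) (auto simp: field_simps power_mult_distrib power_inverse)
  qed
  ultimately show ?thesis by (simp add: Lim_transform_eventually poly_0_coeff_0)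
qed

text \<open>
  When \<open>\<phi>\<close> runs over the directions into the upper half-plane, \<open>m \<phi>\<close> covers more than a half-turn as soon as
  \<open>m \<ge> 2\<close>, so \<open>sin (m \<phi>)\<close> takes both signs. Applied to the leading behaviour of an R-function at infinity or
  at a pole, this bounds the order of vanishing or of the pole by \<open>1\<close>.
\<close>

lemma ray_angle:
  fixes c :: real
  assumes "m \<ge> 2" and sgn: "\<And>\<phi>. 0 < \<phi> \<Longrightarrow> \<phi> < pi \<Longrightarrow> c * sin (real m * \<phi>) \<ge> 0"
  shows "c = 0"
proof -
  have m: "real m > 0" "real m \<ge> 2" using assms(1) by auto
  have "pi / 2 / m < pi" "3 * pi / 2 / m < pi"
    using m by (simp_all add: field_simps)
  then have "c * sin (m * (pi / 2 / m)) \<ge> 0" "c * sin (m * (3 * pi / 2 / m)) \<ge> 0"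
    using m by (intro sgn; simp)+
  moreover have "sin (3 * pi / 2) = - 1" using sin_3over2_pi by simp
  moreover have "m * (pi / 2 / m) = pi / 2" "m * (3 * pi / 2 / m) = 3 * pi / 2"
    using m by simp_all
  ultimately show ?thesis by (simp only: sin_pi_half)
qed

text \<open>
  Along the ray in direction \<open>\<phi>\<close> the quotient \<open>P/Q\<close> behaves like a constant times \<open>(t e\<^bsup>i\<phi>\<^esup>)\<^bsup>-m\<^esup>\<close> with
  \<open>m = deg Q - deg P\<close>.
\<close>

lemma degree_drop_le_1:
  fixes P Q :: "real poly"
  assumes im: "\<And>z. Im z > 0 \<Longrightarrow> Im (poly (cpoly P) z * cnj (poly (cpoly Q) z)) \<le> 0"
    and nz: "P \<noteq> 0" "Q \<noteq> 0"
  shows "degree Q \<le> degree P + 1"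
proof (rule ccontr)
  assume drop: "\<not> ?thesis"
  define m where "m = degree Q - degree P"
  have m: "m \<ge> 2" "degree Q = degree P + m" using drop by (auto simp: m_def)
  have "lead_coeff P * lead_coeff Q * sin (real m * \<phi>) \<ge> 0" if \<phi>: "0 < \<phi>" "\<phi> < pi" for \<phi>
  proof -
    define w where "w = cis \<phi>"
    have w: "w \<noteq> 0" by (simp add: w_def)
    have "((\<lambda>t. Im ((poly (cpoly P) (of_real t * w) / of_real t ^ degree P) *
         cnj (poly (cpoly Q) (of_real t * w) / of_real t ^ degree Q))) \<longlongrightarrow>
        Im ((of_real (lead_coeff P) * w ^ degree P) * cnj (of_real (lead_coeff Q) * w ^ degree Q))) at_top"
      by (intro tendsto_intros cpoly_ray_at_top w)
    moreover have "eventually (\<lambda>t. Im ((poly (cpoly P) (of_real t * w) / of_real t ^ degree P) *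
         cnj (poly (cpoly Q) (of_real t * w) / of_real t ^ degree Q)) \<le> 0) at_top"
      using eventually_gt_at_top[of 0]
    proof eventually_elim
      case (elim t)
      have "(poly (cpoly P) (of_real t * w) / of_real t ^ degree P) *
         cnj (poly (cpoly Q) (of_real t * w) / of_real t ^ degree Q) =
         (poly (cpoly P) (of_real t * w) * cnj (poly (cpoly Q) (of_real t * w))) /
           of_real (t ^ degree P * t ^ degree Q)" by simp
      moreover have "Im (of_real t * w) > 0" using elim \<phi> by (simp add: w_def sin_gt_zero)
      ultimately show ?case
        using im[of "of_real t * w"] elim by (simp only: Im_divide_of_real) (simp add: divide_le_0_iff)
    qed
    ultimately have "Im ((of_real (lead_coeff P) * w ^ degree P) *
        cnj (of_real (lead_coeff Q) * w ^ degree Q)) \<le> 0"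
      by (intro tendsto_upperbound) auto
    moreover have "w ^ degree P * cnj (w ^ degree Q) = cis (- (real m * \<phi>))"
      unfolding w_def m(2) by (simp add: Complex.DeMoivre cis_cnj cis_mult algebra_simps)
    moreover have "(of_real (lead_coeff P) * w ^ degree P) * cnj (of_real (lead_coeff Q) * w ^ degree Q) =
        of_real (lead_coeff P * lead_coeff Q) * (w ^ degree P * cnj (w ^ degree Q))"
      by (simp only: complex_cnj_mult complex_cnj_complex_of_real of_real_mult mult_ac)
    ultimately have "Im (of_real (lead_coeff P * lead_coeff Q) * cis (- (real m * \<phi>))) \<le> 0"
      by (simp only:)
    then show ?thesis by simp
  qed
  then have "lead_coeff P * lead_coeff Q = 0" by (rule ray_angle[OF m(1)])
  then show False using nz by simp
qed

text \<open>
  Near \<open>x\<close> the quotient \<open>P/Q\<close> behaves like a constant times \<open>(t e\<^bsup>i\<phi>\<^esup>)\<^bsup>-m\<^esup>\<close>, where \<open>m\<close> is the order of the zero.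
\<close>

lemma order_le_1:
  fixes P Q :: "real poly"
  assumes im: "\<And>z. Im z > 0 \<Longrightarrow> Im (poly (cpoly P) z * cnj (poly (cpoly Q) z)) \<le> 0"
    and nz: "poly P x \<noteq> 0" "Q \<noteq> 0"
  shows "order x Q \<le> 1"
proof (rule ccontr)
  assume drop: "\<not> ?thesis"
  define m where "m = order x Q"
  have m: "m \<ge> 2" using drop by (simp add: m_def)
  obtain Q1 where Q1: "Q = [:- x, 1:] ^ m * Q1" and nd: "\<not> [:- x, 1:] dvd Q1"
    using order_decomp[OF nz(2), of x] unfolding m_def by blast
  have Q1x: "poly Q1 x \<noteq> 0" using nd by (simp add: poly_eq_0_iff_dvd)
  have cQ: "poly (cpoly Q) z = (z - of_real x) ^ m * poly (cpoly Q1) z" for z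
  proof -
    have "poly (cpoly ([:- x, 1:] ^ j)) z = (z - of_real x) ^ j" for j
      by (induction j) (simp_all add: cpoly_mult map_poly_pCons algebra_simps del: mult_pCons_left)
    then show ?thesis by (simp add: Q1 cpoly_mult)
  qed
  have "poly P x * poly Q1 x * sin (real m * \<phi>) \<ge> 0" if \<phi>: "0 < \<phi>" "\<phi> < pi" for \<phi>
  proof -
    define z where "z = (\<lambda>t. of_real x + of_real t * cis \<phi>)"
    have z: "(z \<longlongrightarrow> of_real x) (at_right 0)" unfolding z_def by (auto intro!: tendsto_eq_intros)
    have "((\<lambda>t. Im (poly (cpoly P) (z t) * cnj (poly (cpoly Q1) (z t) * cis \<phi> ^ m))) \<longlongrightarrow>
      Im (poly (cpoly P) (of_real x) * cnj (poly (cpoly Q1) (of_real x) * cis \<phi> ^ m))) (at_right 0)"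
      by (intro tendsto_intros z)
    moreover have "eventually (\<lambda>t. Im (poly (cpoly P) (z t) * cnj (poly (cpoly Q1) (z t) * cis \<phi> ^ m)) \<le> 0)
        (at_right 0)"
      using eventually_at_right_less[of 0]
    proof eventually_elim
      case (elim t)
      have "poly (cpoly P) (z t) * cnj (poly (cpoly Q) (z t)) =
        of_real (t ^ m) * (poly (cpoly P) (z t) * cnj (poly (cpoly Q1) (z t) * cis \<phi> ^ m))"
        by (simp add: cQ z_def power_mult_distrib)
      moreover have Im_real: "Im (of_real r * u) = r * Im u" for r u by simp
      moreover have "Im (z t) > 0" using elim \<phi> by (simp add: z_def sin_gt_zero)
      ultimately have "t ^ m * Im (poly (cpoly P) (z t) * cnj (poly (cpoly Q1) (z t) * cis \<phi> ^ m)) \<le> 0"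
        using im[of "z t"] Im_real by (simp only:)
      then show ?case using elim by (meson linorder_not_le mult_pos_pos zero_less_power)
    qed
    ultimately have "Im (poly (cpoly P) (of_real x) * cnj (poly (cpoly Q1) (of_real x) * cis \<phi> ^ m)) \<le> 0"
      by (intro tendsto_upperbound) auto
    then show ?thesis by (simp add: Complex.DeMoivre mult.assoc)
  qed
  then have "poly P x * poly Q1 x = 0" by (rule ray_angle[OF m])
  then show False using nz Q1x by simp
qed

lemma coprime_no_common_root:
  fixes P Q :: "real poly"
  assumes "coprime Q P" "poly (cpoly Q) u = 0"
  shows "poly (cpoly P) u \<noteq> 0"
proof
  assume P: "poly (cpoly P) u = 0"
  have "fst (bezout_coefficients Q P) * Q + snd (bezout_coefficients Q P) * P = 1"
    using assms(1) by (simp add: bezout_coefficients_fst_snd)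
  then have "poly (cpoly (fst (bezout_coefficients Q P) * Q + snd (bezout_coefficients Q P) * P)) u = 1"
    by simp
  then show False using P assms(2) by (simp add: cpoly_add cpoly_mult)
qed

section \<open>From R-functions to generalized Hurwitz polynomials\<close>

lemma R_function_even_part:
  assumes "R_function (assoc_fun p)"
  shows "even_part p \<noteq> 0"
proof
  assume "even_part p = 0"
  then show False using assms assoc_fun_even_part_0[of p]
    by (auto simp: R_function_def dest: spec[of _ \<i>])
qed

lemma R_function_odd_part:
  assumes "R_function (assoc_fun p)"
  shows "odd_part p \<noteq> 0"
proof
  assume "odd_part p = 0"
  then have "assoc_fun p = (\<lambda>_. 0)" by (simp add: assoc_fun_def fun_eq_iff)
  then show False using assms by (auto simp: R_function_def dest: spec[of _ \<i>])
qed

text \<open>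
  A zero \<open>z\<close> in the open first quadrant would give \<open>\<Phi>(z\<^sup>2) = -1/z\<close>, a value in the upper half-plane at a point
  of the upper half-plane; a nonzero zero on the imaginary axis would be a common zero of both parts.
\<close>

lemma R_function_imp_generalized_hurwitz:
  assumes lead: "lead_coeff p > 0" and R: "R_function (assoc_fun p)"
    and card: "degree (even_part p) \<le> num_poles (assoc_fun p)"
  shows "generalized_hurwitz p"
proof -
  have nz: "even_part p \<noteq> 0" using R by (rule R_function_even_part)
  note roots = maximal_poles_imp_real_coprime[OF R card nz]
  have no_common: "\<not> (poly (even_part p) x = 0 \<and> poly (odd_part p) x = 0)" for x
    using roots(2)[of "of_real x"] by auto
  have upper: False if z: "poly (cpoly p) z = 0" "Im z > 0" "Re z \<ge> 0" for z
  proof (cases "Re z = 0")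
    case True
    then have sq: "z\<^sup>2 = of_real (- (Im z)\<^sup>2)" by (simp add: complex_eq_iff power2_eq_square)
    then have "of_real (poly (even_part p) (- (Im z)\<^sup>2)) + z * of_real (poly (odd_part p) (- (Im z)\<^sup>2)) = 0"
      using z(1) cpoly_even_odd[of p z] by (simp only: poly_cpoly_of_real)
    then have "poly (even_part p) (- (Im z)\<^sup>2) = 0" "poly (odd_part p) (- (Im z)\<^sup>2) = 0"
      using True z(2) by (auto simp: complex_eq_iff)
    then show False using no_common by blast
  next
    case False
    then have Im2: "Im (z\<^sup>2) > 0" using z by (simp add: power2_eq_square)
    \<comment> \<open>All zeros of the even part are real, but \<open>z\<^sup>2\<close> is not.\<close>
    then have Q: "poly (cpoly (even_part p)) (z\<^sup>2) \<noteq> 0"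
      using roots(1)[of "z\<^sup>2"] by (auto simp: complex_is_Real_iff)
    have "z \<noteq> 0" using z(2) by auto
    then have "assoc_fun p (z\<^sup>2) = - inverse z"
      unfolding assoc_fun_eq[OF Q] using z(1) Q unfolding cpoly_even_odd[of p z]
      by (simp add: field_simps add_eq_0_iff)
    moreover have "Im (- inverse z) > 0" using z(2) by (simp add: sum_power2_gt_zero_iff)
    ultimately show False using R Im2 by (auto simp: R_function_def dest: spec[of _ "z\<^sup>2"])
  qed
  show ?thesis
  proof (rule generalized_hurwitzI[OF lead])
    fix z assume z: "poly (cpoly p) z = 0" "Re z \<ge> 0"
    then have "\<not> Im z > 0" "\<not> Im (cnj z) > 0" using upper[of z] upper[of "cnj z"] by auto
    then show "z \<in> \<real>" by (simp add: complex_is_Real_iff)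
  next
    show "poly (even_part p * pderiv (odd_part p) - pderiv (even_part p) * odd_part p) x \<le> 0" for x
      by (rule wronskian_nonpos) (rule R_function_Im[OF nz R])
  qed (rule no_common)
qed

lemma R_function_degree_odd_part:
  assumes "R_function (assoc_fun p)"
  shows "degree (even_part p) \<le> degree (odd_part p) + 1"
  using assms R_function_even_part R_function_odd_part R_function_Im
  by (intro degree_drop_le_1) blast+

text \<open>
  Without cancellation the poles are the zeros of \<open>e\<close>. They are real, as an R-function has none in the upper
  half-plane, and simple by \<open>order_le_1\<close>.
\<close>

lemma num_poles_coprime:
  assumes R: "R_function (assoc_fun p)" and cop: "coprime (even_part p) (odd_part p)"
  shows "num_poles (assoc_fun p) = degree (even_part p)"
proof -
  let ?Q = "cpoly (even_part p)"
  have nz: "even_part p \<noteq> 0" using R by (rule R_function_even_part)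
  then have Q0: "?Q \<noteq> 0" by simp
  have pole: "is_pole (assoc_fun p) u \<longleftrightarrow> poly ?Q u = 0" for u
    unfolding is_pole_assoc_fun_iff[OF nz]
    using rational_not_pole(1) rational_pole[OF Q0] coprime_no_common_root[OF cop] by blast
  have simple: "order u ?Q = 1" if u: "poly ?Q u = 0" for u
  proof -
    have "\<not> Im u > 0" "\<not> Im (cnj u) > 0"
      using R u pole[of u] pole[of "cnj u"] by (auto simp: R_function_def)
    then obtain x where x: "u = of_real x"
      by (metis complex_is_Real_iff Reals_cases complex_cnj_cancel_iff linorder_neqE_linordered_idom
          neg_0_less_iff_less cnj.simps(2))
    have root: "poly (even_part p) x = 0" and "poly (odd_part p) x \<noteq> 0"
      using u coprime_no_common_root[OF cop u] by (auto simp: x)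
    then have "order x (even_part p) \<le> 1"
      using R_function_Im[OF nz R] nz by (intro order_le_1)
    moreover have "order x (even_part p) \<noteq> 0" using root nz order_root by blast
    ultimately have "order x (even_part p) = 1" by simp
    then have "poly (pderiv (even_part p)) x \<noteq> 0" using simple_root_iff_pderiv nz root by blast
    then have "poly (pderiv ?Q) u \<noteq> 0" by (simp add: x cpoly_pderiv)
    then show ?thesis using simple_root_iff_pderiv[OF Q0 u] by blast
  qed
  have "card {u. poly ?Q u = 0} = degree ?Q" using card_roots_eq_degree_iff[OF Q0] simple by blast
  then show ?thesis by (simp add: num_poles_def pole)
qed

section \<open>The argument of a polynomial along the imaginary axis\<close>

text \<open>
  The angle of \<open>iy - z\<close> for \<open>Re z < 0\<close>, the angle of \<open>z - iy\<close> for \<open>Re z > 0\<close>, and the angle of \<open>iy\<close> itself for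
  \<open>z = 0\<close> and \<open>y > 0\<close>. Passing to \<open>z - iy\<close> keeps the point in the open right half-plane, where arctangent is a
  continuous argument; the sign is accounted for separately.
\<close>

definition root_angle :: "complex \<Rightarrow> real \<Rightarrow> real" where
  "root_angle z y =
     (if Re z < 0 then arctan ((y - Im z) / (- Re z))
      else if Re z > 0 then - arctan ((y - Im z) / Re z) else pi / 2)"

definition axis_angle :: "complex multiset \<Rightarrow> real \<Rightarrow> real" where
  "axis_angle A y = (\<Sum>z\<in>#A. root_angle z y)"

text \<open>
  For \<open>a > 0\<close> the principal argument is an arctangent. Arctangents of the individual factors are used below
  because, unlike \<open>Arg\<close> of their product, they add up to a continuous function.
\<close>

lemma polar_arctan:
  assumes "a > 0"
  shows "Complex a b = of_real (cmod (Complex a b)) * cis (arctan (b / a))"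
proof -
  define t where "t = b / a"
  have b: "b = a * t" using assms by (simp add: t_def)
  define s where "s = sqrt (1 + t\<^sup>2)"
  have "s > 0" unfolding s_def by (intro real_sqrt_gt_zero add_pos_nonneg) auto
  have "a\<^sup>2 + b\<^sup>2 = a\<^sup>2 * (1 + t\<^sup>2)" by (simp add: b power_mult_distrib distrib_left)
  then have "cmod (Complex a b) = a * s"
    using assms by (simp add: complex_norm real_sqrt_mult s_def)
  moreover have "cis (arctan t) = Complex (1 / s) (t / s)"
    by (simp add: complex_eq_iff cos_arctan sin_arctan s_def)
  ultimately show ?thesis
    using \<open>s > 0\<close> unfolding t_def[symmetric] by (simp add: complex_eq_iff b)
qed

lemma root_factor_polar:
  assumes "y > 0" "Re z = 0 \<Longrightarrow> z = 0"
  shows "\<exists>r>0. \<i> * of_real y - z = of_real (r * (- 1) ^ of_bool (Re z > 0)) * cis (root_angle z y)"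
proof -
  consider "Re z < 0" | "Re z > 0" | "z = 0" using assms(2) by linarith
  then show ?thesis
  proof cases
    case 1
    have "\<i> * of_real y - z = Complex (- Re z) (y - Im z)" by (simp add: complex_eq_iff)
    also have "\<dots> = of_real (cmod (Complex (- Re z) (y - Im z))) * cis (root_angle z y)"
      using polar_arctan[of "- Re z" "y - Im z"] 1 by (simp add: root_angle_def)
    moreover have "cmod (Complex (- Re z) (y - Im z)) > 0" using 1 by (simp add: complex_eq_iff)
    ultimately show ?thesis using 1 by (intro exI[of _ "cmod (Complex (- Re z) (y - Im z))"]) simp
  next
    case 2
    have "\<i> * of_real y - z = - cnj (Complex (Re z) (y - Im z))" by (simp add: complex_eq_iff)
    also have "Complex (Re z) (y - Im z) =
        of_real (cmod (Complex (Re z) (y - Im z))) * cis (arctan ((y - Im z) / Re z))"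
      by (rule polar_arctan) (rule 2)
    also have "- cnj \<dots> = of_real (cmod (Complex (Re z) (y - Im z)) * (- 1)) * cis (root_angle z y)"
      using 2 by (simp add: root_angle_def cis_cnj)
    moreover have "cmod (Complex (Re z) (y - Im z)) > 0" using 2 by (simp add: complex_eq_iff)
    ultimately show ?thesis using 2 by (intro exI[of _ "cmod (Complex (Re z) (y - Im z))"]) simp
  next
    case 3
    then show ?thesis using assms(1) by (intro exI[of _ y]) (simp add: root_angle_def mult.commute)
  qed
qed

lemma root_product_polar:
  assumes "y > 0" "\<And>z. z \<in># A \<Longrightarrow> Re z = 0 \<Longrightarrow> z = 0"
  shows "\<exists>r>0. (\<Prod>z\<in>#A. \<i> * of_real y - z) =
    of_real (r * (- 1) ^ size {#z \<in># A. Re z > 0#}) * cis (axis_angle A y)"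
  using assms(2)
proof (induction A)
  case empty
  show ?case by (intro exI[of _ 1]) (simp add: axis_angle_def)
next
  case (add z A)
  obtain r where r: "r > 0" "(\<Prod>z\<in>#A. \<i> * of_real y - z) =
      of_real (r * (- 1) ^ size {#z \<in># A. Re z > 0#}) * cis (axis_angle A y)"
    using add.IH add.prems by auto
  obtain s where s: "s > 0" "\<i> * of_real y - z =
      of_real (s * (- 1) ^ of_bool (Re z > 0)) * cis (root_angle z y)"
    using root_factor_polar[OF assms(1), of z] add.prems by auto
  have "axis_angle (add_mset z A) y = root_angle z y + axis_angle A y"
    by (simp add: axis_angle_def)
  then have "cis (axis_angle (add_mset z A) y) = cis (root_angle z y) * cis (axis_angle A y)"
    by (simp add: cis_mult)
  moreover have "(- 1 :: real) ^ size {#w \<in># add_mset z A. Re w > 0#} =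
      (- 1) ^ of_bool (Re z > 0) * (- 1) ^ size {#w \<in># A. Re w > 0#}" by simp
  moreover have "(\<Prod>w\<in>#add_mset z A. \<i> * of_real y - w) =
      (\<i> * of_real y - z) * (\<Prod>w\<in>#A. \<i> * of_real y - w)" by simp
  ultimately have "(\<Prod>w\<in>#add_mset z A. \<i> * of_real y - w) =
    of_real ((s * r) * (- 1) ^ size {#w \<in># add_mset z A. Re w > 0#}) * cis (axis_angle (add_mset z A) y)"
    by (simp only: r(2) s(2) of_real_mult mult_ac)
  then show ?case using r(1) s(1) by (intro exI[of _ "s * r"]) simp
qed

lemma poly_prod_mset_linear:
  "poly (\<Prod>z\<in>#A. [:- z, 1:]) x = (\<Prod>z\<in>#A. x - (z :: complex))"
  by (induction A) (auto simp: algebra_simps)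

text \<open>
  Moving up the imaginary axis, each zero in the left half-plane turns the argument of \<open>p(iy)\<close> forwards
  and each zero in the right half-plane turns it backwards, where the fixed sign of its real part is moved
  into the modulus.
\<close>

lemma poly_imaginary_axis_polar:
  assumes lead: "lead_coeff p > 0" and y: "y > 0"
    and axis: "\<And>z. poly (cpoly p) z = 0 \<Longrightarrow> Re z = 0 \<Longrightarrow> z = 0"
  shows "\<exists>r>0. poly (cpoly p) (\<i> * of_real y) =
    of_real (r * (- 1) ^ size {#z \<in># proots (cpoly p). Re z > 0#}) * cis (axis_angle (proots (cpoly p)) y)"
proof -
  let ?A = "proots (cpoly p)"
  have "p \<noteq> 0" using lead by auto
  then have "Re z = 0 \<Longrightarrow> z = 0" if "z \<in># ?A" for z using axis that by simp
  then obtain r where r: "r > 0" "(\<Prod>z\<in>#?A. \<i> * of_real y - z) =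
      of_real (r * (- 1) ^ size {#z \<in># ?A. Re z > 0#}) * cis (axis_angle ?A y)"
    using root_product_polar[OF y, of ?A] by blast
  have "poly (cpoly p) (\<i> * of_real y) = poly (smult (lead_coeff (cpoly p)) (\<Prod>z\<in>#?A. [:- z, 1:])) (\<i> * of_real y)"
    by (subst complex_poly_decompose_multiset) simp
  also have "\<dots> = of_real ((lead_coeff p * r) * (- 1) ^ size {#z \<in># ?A. Re z > 0#}) * cis (axis_angle ?A y)"
    by (simp only: poly_smult poly_prod_mset_linear r(2)) simp
  finally show ?thesis using r(1) lead by (intro exI[of _ "lead_coeff p * r"]) simp
qed

lemma continuous_axis_angle: "isCont (axis_angle A) y"
proof -
  have "isCont (root_angle z) y" for z
    unfolding root_angle_def
    by (cases "Re z < 0"; cases "Re z > 0") (auto intro!: continuous_intros)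
  then have "isCont (\<lambda>y. \<Sum>z\<in>#A. root_angle z y) y"
    by (induction A) (auto intro!: continuous_intros)
  then show ?thesis unfolding axis_angle_def .
qed

lemma tendsto_axis_angle_at_top:
  "(axis_angle A \<longlongrightarrow> pi / 2 * (real (size A) - 2 * real (size {#z \<in># A. Re z > 0#}))) at_top"
proof -
  have lim: "((\<lambda>y. arctan ((y - b) / a)) \<longlongrightarrow> pi / 2) at_top" if "a > 0" for a b :: real
  proof (rule filterlim_compose[OF tendsto_arctan_at_top])
    have "filterlim (\<lambda>y. inverse a * (- b + y)) at_top at_top"
      using that by (intro filterlim_tendsto_pos_mult_at_top[OF tendsto_const]
          filterlim_tendsto_add_at_top[OF tendsto_const] filterlim_ident) auto
    then show "LIM y at_top. (y - b) / a :> at_top"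
      by (simp add: field_simps)
  qed
  have *: "(root_angle z \<longlongrightarrow> pi / 2 * (1 - 2 * of_bool (Re z > 0))) at_top" for z
    using lim[of "- Re z" "Im z"] tendsto_minus[OF lim[of "Re z" "Im z"]]
    by (cases "Re z < 0"; cases "Re z > 0") (auto simp: root_angle_def[abs_def])
  show ?thesis
    unfolding axis_angle_def
  proof (induction A)
    case (add z A)
    have eq: "pi / 2 * (real (size (add_mset z A)) - 2 * real (size {#w \<in># add_mset z A. Re w > 0#})) =
        pi / 2 * (1 - 2 * of_bool (Re z > 0)) + pi / 2 * (real (size A) - 2 * real (size {#w \<in># A. Re w > 0#}))"
      by (auto simp: field_simps)
    show ?case
      unfolding eq using tendsto_add[OF *[of z] add.IH] by simp
  qed simp
qed

text \<open>
  Conjugating all linear factors of \<open>p\<close> gives back \<open>p\<close>.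
\<close>

lemma mset_cnj_proots: "image_mset cnj (proots (cpoly p)) = proots (cpoly p)"
proof (cases "p = 0")
  case False
  let ?A = "proots (cpoly p)"
  have dec: "smult (lead_coeff (cpoly p)) (\<Prod>z\<in>#?A. [:- z, 1:]) = cpoly p"
    by (rule complex_poly_decompose_multiset)
  have "poly (cpoly p) x = poly (smult (lead_coeff (cpoly p)) (\<Prod>z\<in>#image_mset cnj ?A. [:- z, 1:])) x" for x
  proof -
    have "poly (cpoly p) x = cnj (poly (cpoly p) (cnj x))" by simp
    also have "\<dots> = cnj (lead_coeff (cpoly p)) * cnj (\<Prod>z\<in>#?A. cnj x - z)"
      by (subst dec[symmetric]) (simp add: poly_prod_mset_linear)
    also have "cnj (\<Prod>z\<in>#B. cnj x - z) = (\<Prod>z\<in>#image_mset cnj B. x - z)" for B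
      by (induction B) auto
    finally show ?thesis by (simp add: poly_prod_mset_linear)
  qed
  then have "cpoly p = smult (lead_coeff (cpoly p)) (\<Prod>z\<in>#image_mset cnj ?A. [:- z, 1:])"
    by (intro poly_eq_poly_eq_iff[THEN iffD1] ext)
  then have "?A = proots (smult (lead_coeff (cpoly p)) (\<Prod>z\<in>#image_mset cnj ?A. [:- z, 1:]))"
    by simp
  also have "\<dots> = proots (\<Prod>z\<in>#image_mset cnj ?A. [:- z, 1:])"
    using False by (intro proots_smult) simp
  also have "\<dots> = image_mset cnj ?A"
  proof -
    have "proots (\<Prod>z\<in>#B. [:- z, 1:]) = B" for B :: "complex multiset"
    proof (induction B)
      case (add b B)
      have "(\<Prod>z\<in>#B. [:- z, 1:]) \<noteq> 0"
        by (simp add: prod_mset_zero_iff image_iff)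
      then show ?case using add proots_mult[of "[:- b, 1:]" "\<Prod>z\<in>#B. [:- z, 1:]"]
        by (simp del: mult_pCons_left)
    qed simp
    then show ?thesis .
  qed
  finally show ?thesis ..
qed simp

text \<open>
  At \<open>y = 0\<close> the angles of conjugate zeros cancel, and the angle of a real nonzero one is \<open>0\<close>; only zeros on the
  imaginary axis itself remain.
\<close>

lemma axis_angle_0:
  "axis_angle (proots (cpoly p)) 0 = pi / 2 * real (size {#z \<in># proots (cpoly p). Re z = 0#})"
proof -
  let ?A = "proots (cpoly p)"
  have "axis_angle ?A 0 = axis_angle (image_mset cnj ?A) 0" by (simp only: mset_cnj_proots)
  also have "\<dots> = (\<Sum>z\<in>#?A. root_angle (cnj z) 0)" by (simp add: axis_angle_def image_mset.compositionality comp_def)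
  also have "\<dots> = (\<Sum>z\<in>#?A. pi * of_bool (Re z = 0) - root_angle z 0)"
    by (intro arg_cong[of _ _ sum_mset] image_mset_cong) (auto simp: root_angle_def arctan_minus)
  also have "(\<Sum>z\<in>#B. pi * of_bool (Re z = 0) - root_angle z 0) =
      pi * real (size {#z \<in># B. Re z = 0#}) - axis_angle B 0" for B
    unfolding axis_angle_def by (induction B) (auto simp: algebra_simps)
  finally show ?thesis by simp
qed

text \<open>
  The points are found from left to right: after \<open>f\<close> has taken the value \<open>c j\<close> it must still take the next
  level, because it finally exceeds it.
\<close>

lemma level_crossings:
  fixes f :: "real \<Rightarrow> real" and c :: "nat \<Rightarrow> real"
  assumes cont: "\<And>y. isCont f y" and start: "m > 0 \<Longrightarrow> f a < c 0" and c: "\<And>j. c j < c (Suc j)"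
    and ev: "\<And>j. j < m \<Longrightarrow> eventually (\<lambda>y. f y > c j) at_top"
  shows "\<exists>y. strict_mono_on {..<m} y \<and> (\<forall>j<m. y j > a \<and> f (y j) = c j)"
  using start ev
proof (induction m)
  case (Suc m)
  then obtain y where y: "strict_mono_on {..<m} y" "\<forall>j<m. y j > a \<and> f (y j) = c j" by auto
  define b where "b = (if m = 0 then a else y (m - 1))"
  have fb: "f b < c m"
    using Suc.prems(1) y(2) c[of "m - 1"] by (cases m) (auto simp: b_def)
  have ab: "a \<le> b" using y(2) by (auto simp: b_def intro: less_imp_le)
  have yb: "y j \<le> b" if "j < m" for j
    using strict_mono_on_leD[OF y(1), of j "m - 1"] that by (auto simp: b_def)
  have "eventually (\<lambda>y. f y > c m \<and> y > b) at_top"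
    using Suc.prems(2)[of m] eventually_gt_at_top[of b] by (intro eventually_conj) auto
  then obtain Y where Y: "f Y > c m" "Y > b" using eventually_happens[of _ "at_top :: real filter"] by auto
  obtain x where x: "b \<le> x" "x \<le> Y" "f x = c m"
    using IVT[of f b "c m" Y] fb Y cont by auto
  then have "b < x" using fb by (cases "b = x") auto
  have "strict_mono_on {..<Suc m} (y(m := x))"
    using y(1) yb \<open>b < x\<close> by (fastforce simp: strict_mono_on_def less_Suc_eq)
  moreover have "\<forall>j<Suc m. (y(m := x)) j > a \<and> f ((y(m := x)) j) = c j"
    using y(2) x(3) \<open>b < x\<close> ab by (auto simp: less_Suc_eq)
  ultimately show ?case by blast
qed auto

lemma imaginary_axis_parts:
  "poly (cpoly p) (\<i> * of_real y) =
    Complex (poly (even_part p) (- y\<^sup>2)) (y * poly (odd_part p) (- y\<^sup>2))"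
proof -
  have "(\<i> * of_real y)\<^sup>2 = complex_of_real (- y\<^sup>2)" by (simp add: power_mult_distrib)
  then show ?thesis
    unfolding cpoly_even_odd[of p "\<i> * of_real y"] by (simp only: poly_cpoly_of_real) (simp add: complex_eq_iff)
qed

lemma cis_odd_multiple: "cis (pi / 2 + real j * pi) = \<i> * (- 1) ^ j"
proof -
  have "cis (pi / 2 + real j * pi) = \<i> * cis pi ^ j"
    by (simp only: cis_mult[symmetric] cis_pi_half Complex.DeMoivre)
  then show ?thesis by (simp only: cis_pi)
qed

text \<open>
  The angle of \<open>p(iy)\<close> starts at \<open>m\<^sub>0 \<pi>/2\<close>, where \<open>m\<^sub>0\<close> counts the zero at the origin, and tends to
  \<open>(n - 2N) \<pi>/2\<close>, where \<open>N\<close> is the number of zeros in the open right half-plane. It crosses the levels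
  \<open>\<pi>/2 + (m\<^sub>0 + j) \<pi>\<close> in between, at which \<open>p(iy)\<close> is purely imaginary of known sign. When
  \<open>2 (k + m) = n + 1\<close>, the last level equals the limit; it is still attained if the second coefficient is
  negative, because then the sign of \<open>e\<close> near \<open>-\<infinity>\<close> forces the angle to approach its limit from above.
\<close>

lemma negative_zeros:
  fixes p :: "real poly"
  defines "A \<equiv> proots (cpoly p)"
  assumes lead: "lead_coeff p > 0"
    and axis: "\<And>z. poly (cpoly p) z = 0 \<Longrightarrow> Re z = 0 \<Longrightarrow> z = 0"
    and k: "k = size {#z \<in># A. Re z \<ge> 0#}"
    and m: "2 * (k + m) \<le> degree p \<or> 2 * (k + m) = degree p + 1 \<and> coeff p (degree p - 1) < 0"
  shows "\<exists>y. strict_mono_on {..<m} y \<and> (\<forall>j<m. y j > 0 \<and> poly (even_part p) (- (y j)\<^sup>2) = 0 \<and>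
    (- 1) ^ (k + j) * poly (odd_part p) (- (y j)\<^sup>2) > 0)"
proof -
  define N where "N = size {#z \<in># A. Re z > 0#}"
  define m0 where "m0 = size {#z \<in># A. Re z = 0#}"
  define f where "f = axis_angle A"
  define L where "L = pi / 2 * (real (degree p) - 2 * real N)"
  \<comment> \<open>At these levels \<open>cis\<close> is \<open>\<plusminus>i\<close>, alternately; the first one is the first above the initial value \<open>m\<^sub>0 \<pi>/2\<close>.\<close>
  define c where "c = (\<lambda>j. pi / 2 + real (m0 + j) * pi)"
  have "{#z \<in># A. Re z \<ge> 0#} = {#z \<in># A. Re z > 0#} + {#z \<in># A. Re z = 0#}"
    by (intro multiset_eqI) auto
  then have k_eq: "k = N + m0" by (simp add: k N_def m0_def)
  have "size A = degree p" by (simp add: A_def size_proots_complex)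
  then have lim: "(f \<longlongrightarrow> L) at_top"
    unfolding f_def L_def N_def using tendsto_axis_angle_at_top[of A] by simp
  have cont: "isCont f y" for y unfolding f_def by (rule continuous_axis_angle)
  have polar: "\<exists>r>0. poly (cpoly p) (\<i> * of_real y) = of_real (r * (- 1) ^ N) * cis (f y)" if "y > 0" for y
    unfolding f_def N_def A_def using poly_imaginary_axis_polar[OF lead that axis] by blast
  \<comment> \<open>The zero at the origin has the constant angle \<open>\<pi>/2\<close>, so the formula at \<open>0\<close> is the limit from the right.\<close>
  have "f 0 = pi / 2 * real m0"
    unfolding f_def m0_def A_def by (rule axis_angle_0)
  also have "\<dots> < c 0"
  proof -
    have "0 < pi + pi * real m0" by (intro add_pos_nonneg) auto
    then show ?thesis by (simp add: c_def field_simps)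
  qed
  finally have start: "f 0 < c 0" .
  have step: "c j < c (Suc j)" for j by (simp add: c_def algebra_simps)
  have ev: "eventually (\<lambda>y. f y > c j) at_top" if j: "j < m" for j
  proof (cases "2 * (k + m) \<le> degree p")
    case True
    then have "2 * (N + m0 + j) + 1 < degree p" using j k_eq by simp
    then have "real (2 * (m0 + j) + 1) < real (degree p) - 2 * real N"
      by (simp flip: of_nat_less_iff[where ?'a = real])
    then have "pi / 2 * real (2 * (m0 + j) + 1) < L" unfolding L_def by simp
    then have "c j < L" by (simp add: c_def algebra_simps)
    then show ?thesis using order_tendstoD(1)[OF lim] by blast
  next
    case False
    then have deg: "2 * (k + m) = degree p + 1" and a1: "coeff p (degree p - 1) < 0" using m by auto
    define l where "l = degree p div 2"
    have l: "degree p = 2 * l + 1" "k + m = l + 1" using deg unfolding l_def by presburger+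
    have N: "N \<le> l" using l(2) j k_eq by simp
    have L: "L = pi / 2 + real (l - N) * pi" unfolding L_def l(1) using N by (simp add: of_nat_diff algebra_simps)
    have "m0 + j \<le> l - N" using j l(2) k_eq by simp
    then have "real (m0 + j) * pi \<le> real (l - N) * pi"
      by (intro mult_right_mono) (simp_all only: of_nat_le_iff pi_ge_zero)
    then have cL: "c j \<le> L" unfolding L c_def by (rule add_left_mono)
    define q where "q = smult (- ((- 1) ^ l)) (pcompose (even_part p) [:0, -1:])"
    have coeff_l: "coeff (even_part p) l = coeff p (degree p - 1)" by (simp add: coeff_even_part l(1))
    have "degree (even_part p) = l"
    proof (rule antisym)
      show "degree (even_part p) \<le> l"
        by (rule degree_le) (auto simp: coeff_even_part l(1) intro!: coeff_eq_0)
      show "l \<le> degree (even_part p)" using a1 coeff_l by (intro le_degree) auto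
    qed
    then have "lead_coeff (pcompose (even_part p) [:0, -1:]) = coeff p (degree p - 1) * (- 1) ^ l"
      using coeff_l by (subst lead_coeff_comp) auto
    then have "lead_coeff q = - coeff p (degree p - 1)"
      unfolding q_def lead_coeff_smult by (simp flip: power_mult_distrib)
    then have "lead_coeff q > 0" using a1 by simp
    then obtain Y where Y: "\<And>x. x \<ge> Y \<Longrightarrow> poly q x > 0"
      using poly_pinfty_gt_lc[of q] by (meson less_le_trans)
    have "eventually (\<lambda>y. \<bar>f y - L\<bar> < pi / 2) at_top"
      using tendstoD[OF lim, of "pi / 2"] by (simp add: dist_real_def)
    then show ?thesis
      using eventually_gt_at_top[of 0] eventually_ge_at_top[of "max 1 Y"]
    proof eventually_elim
      case (elim y)
      have "y \<le> y\<^sup>2" using elim(3) by (intro self_le_power) auto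
      then have "poly q (y\<^sup>2) > 0" using elim(3) by (intro Y) auto
      then have sgn: "- ((- 1) ^ l) * poly (even_part p) (- y\<^sup>2) > 0"
        by (simp add: q_def poly_pcompose)
      obtain r where r: "r > 0" "poly (cpoly p) (\<i> * of_real y) = of_real (r * (- 1) ^ N) * cis (f y)"
        using polar elim(2) by blast
      have "cis (f y) = cis L * cis (f y - L)" by (simp add: cis_mult)
      also have "cis L = \<i> * (- 1) ^ (l - N)" unfolding L by (rule cis_odd_multiple)
      also have "of_real (r * (- 1) ^ N) * (\<i> * (- 1) ^ (l - N) * cis (f y - L)) =
          of_real (r * (- 1) ^ l) * (\<i> * cis (f y - L))"
        using N by (simp flip: power_add)
      finally have "poly (cpoly p) (\<i> * of_real y) = of_real (r * (- 1) ^ l) * (\<i> * cis (f y - L))"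
        using r(2) by simp
      then have "poly (even_part p) (- y\<^sup>2) = - (r * (- 1) ^ l * sin (f y - L))"
        unfolding imaginary_axis_parts by (simp add: complex_eq_iff)
      then have "r * sin (f y - L) > 0"
        using sgn by (simp add: algebra_simps flip: power_mult_distrib)
      then have sin_pos: "sin (f y - L) > 0" using r(1) by (simp add: zero_less_mult_iff)
      \<comment> \<open>Within \<open>\<pi>/2\<close> of the limit the sign of the sine is the sign of the difference.\<close>
      have "f y - L > 0"
      proof (rule ccontr)
        assume "\<not> ?thesis"
        then have "sin (L - f y) \<ge> 0" using elim(1) by (intro sin_ge_zero) auto
        then show False using sin_pos sin_minus[of "L - f y"] by simp
      qed
      then show ?case using cL by simp
    qed
  qed
  obtain y where y: "strict_mono_on {..<m} y" "\<forall>j<m. y j > 0 \<and> f (y j) = c j"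
    using level_crossings[of f m 0 c, OF cont start step ev] by blast
  have "poly (even_part p) (- (y j)\<^sup>2) = 0 \<and> (- 1) ^ (k + j) * poly (odd_part p) (- (y j)\<^sup>2) > 0"
    if j: "j < m" for j
  proof -
    have yj: "y j > 0" "f (y j) = c j" using y(2) j by auto
    obtain r where r: "r > 0" "poly (cpoly p) (\<i> * of_real (y j)) = of_real (r * (- 1) ^ N) * cis (f (y j))"
      using polar yj(1) by blast
    have "cis (f (y j)) = \<i> * (- 1) ^ (m0 + j)" unfolding yj(2) c_def by (rule cis_odd_multiple)
    then have "poly (cpoly p) (\<i> * of_real (y j)) = \<i> * of_real (r * (- 1) ^ (k + j))"
      using r(2) by (simp add: k_eq power_add)
    then have "poly (even_part p) (- (y j)\<^sup>2) = 0"
      and eq: "y j * poly (odd_part p) (- (y j)\<^sup>2) = r * (- 1) ^ (k + j)"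
      unfolding imaginary_axis_parts by (auto simp: complex_eq_iff)
    moreover have "y j * ((- 1) ^ (k + j) * poly (odd_part p) (- (y j)\<^sup>2)) = r"
    proof -
      have "(- 1) ^ (k + j) * (- 1) ^ (k + j) = (1 :: real)" by (simp flip: power_mult_distrib)
      then have "(- 1) ^ (k + j) * (y j * poly (odd_part p) (- (y j)\<^sup>2)) = r"
        unfolding eq by (metis mult.commute mult.left_commute mult_1_right)
      then show ?thesis by (simp only: mult.left_commute)
    qed
    then have "(- 1) ^ (k + j) * poly (odd_part p) (- (y j)\<^sup>2) > 0"
      using r(1) yj(1) by (metis zero_less_mult_pos)
    ultimately show ?thesis by blast
  qed
  then show ?thesis using y by blast
qed

section \<open>Signs at the zeros of a generalized Hurwitz polynomial\<close>

lemma coeff_prod_linear_factors: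
  fixes A :: "complex multiset"
  assumes "A \<noteq> {#}"
  shows "coeff (\<Prod>z\<in>#A. [:- z, 1:]) (size A - 1) = - (\<Sum>z\<in>#A. z)"
  using assms
proof (induction A)
  case (add a A)
  let ?q = "\<Prod>z\<in>#A. [:- z, 1:]"
  have "degree (\<Prod>z\<in>#B. [:- z, 1:]) = size B \<and> lead_coeff (\<Prod>z\<in>#B. [:- z, 1:]) = 1" for B :: "complex multiset"
  proof (induction B)
    case (add b B)
    then have "(\<Prod>z\<in>#B. [:- z, 1:]) \<noteq> 0" by auto
    then have "degree ([:- b, 1:] * (\<Prod>z\<in>#B. [:- z, 1:])) = Suc (size B)"
      using add by (subst degree_mult_eq) auto
    moreover have "lead_coeff ([:- b, 1:] * (\<Prod>z\<in>#B. [:- z, 1:])) = 1"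
      using add by (subst lead_coeff_mult) auto
    ultimately show ?case by (simp del: mult_pCons_left)
  qed simp
  then have q: "coeff ?q (size A) = 1" by metis
  show ?case
  proof (cases "A = {#}")
    case False
    then obtain m where m: "size A = Suc m" by (metis nonempty_has_size gr0_implies_Suc)
    show ?thesis using add.IH[OF False] q unfolding m by (simp add: m)
  qed simp
qed simp

text \<open>
  By Vieta the second coefficient is \<open>-a\<^sub>0\<close> times the sum of the zeros.
\<close>

lemma second_coeff_pos:
  fixes p :: "real poly"
  assumes lead: "lead_coeff p > 0" and le: "\<And>z. poly (cpoly p) z = 0 \<Longrightarrow> Re z \<le> 0"
    and ex: "poly (cpoly p) w = 0" "Re w < 0"
  shows "coeff p (degree p - 1) > 0"
proof -
  let ?A = "proots (cpoly p)"
  have p0: "p \<noteq> 0" using lead by auto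
  then have w: "w \<in># ?A" using ex by simp
  have size: "size ?A = degree p" by (simp add: size_proots_complex)
  have "of_real (coeff p (degree p - 1)) = coeff (smult (lead_coeff (cpoly p)) (\<Prod>z\<in>#?A. [:- z, 1:])) (size ?A - 1)"
    by (subst complex_poly_decompose_multiset) (simp add: size)
  also have "\<dots> = of_real (lead_coeff p) * - (\<Sum>z\<in>#?A. z)"
  proof -
    have "?A \<noteq> {#}" using w by auto
    from coeff_prod_linear_factors[OF this] show ?thesis by (simp only: coeff_smult coeff_cpoly degree_cpoly)
  qed
  finally have "coeff p (degree p - 1) = lead_coeff p * - Re (\<Sum>z\<in>#?A. z)"
    by (simp add: complex_eq_iff)
  also have "Re (\<Sum>z\<in>#?A. z) < 0"
  proof -
    have le': "Re (\<Sum>z\<in>#B. z) \<le> 0" if "B \<subseteq># ?A" for B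
    proof -
      have "\<forall>z\<in>#B. Re z \<le> 0" using that le p0 by (auto dest!: mset_subset_eqD)
      then show ?thesis by (induction B) auto
    qed
    obtain B where B: "?A = add_mset w B" using w by (metis multi_member_split)
    have "Re (\<Sum>z\<in>#B. z) \<le> 0" by (rule le') (simp add: B)
    then show ?thesis using ex(2) by (simp add: B)
  qed
  then have "lead_coeff p * - Re (\<Sum>z\<in>#?A. z) > 0" using lead by (intro mult_pos_pos) auto
  finally show ?thesis .
qed

lemma zeros_on_right_of:
  fixes p :: "real poly"
  assumes p0: "p \<noteq> 0" and mono: "strict_mono_on {1..k} \<mu>"
    and nonneg: "{x. x \<ge> 0 \<and> poly p x = 0} = \<mu> ` {1..k}"
    and simple: "\<And>i. i \<in> {1..k} \<Longrightarrow> order (\<mu> i) p = 1"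
    and x: "x \<ge> 0" and i: "i \<le> k" "\<And>j. j \<in> {1..k} \<Longrightarrow> x < \<mu> j \<longleftrightarrow> i < j"
  shows "zeros_on p {x<..} = k - i"
proof -
  have mem: "y \<in> \<mu> ` {1..k}" if "y > x" "poly p y = 0" for y
    using that x nonneg by auto
  have "zeros_on p {x<..} = card {y \<in> {x<..}. poly p y = 0}"
    by (intro zeros_on_simple p0) (use mem simple in force)
  also have "{y \<in> {x<..}. poly p y = 0} = \<mu> ` {i<..k}"
  proof (intro equalityI subsetI)
    fix y assume "y \<in> {y \<in> {x<..}. poly p y = 0}"
    then show "y \<in> \<mu> ` {i<..k}" using mem[of y] i(2) by force
  next
    fix y assume "y \<in> \<mu> ` {i<..k}"
    then obtain j where j: "y = \<mu> j" "i < j" "j \<le> k" by auto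
    then have "j \<in> {1..k}" by auto
    then have "poly p (\<mu> j) = 0" "x < \<mu> j" using nonneg i(2) j by auto
    then show "y \<in> {y \<in> {x<..}. poly p y = 0}" using j by simp
  qed
  also have "card \<dots> = card {i<..k}"
    by (intro card_image inj_on_subset[OF strict_mono_on_imp_inj_on[OF mono]]) auto
  finally show ?thesis by simp
qed

text \<open>
  The part of the definition of order \<open>k\<close> from which the zeros of the even part are constructed.
\<close>

locale gen_hurwitz_data =
  fixes p :: "real poly" and k :: nat and \<mu> :: "nat \<Rightarrow> real"
  assumes lead: "lead_coeff p > 0"
    and mono: "strict_mono_on {1..k} \<mu>"
    and closed_rhp: "{z. poly (cpoly p) z = 0 \<and> Re z \<ge> 0} = (\<lambda>i. complex_of_real (\<mu> i)) ` {1..k}"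
    and nonneg: "\<And>i. i \<in> {1..k} \<Longrightarrow> \<mu> i \<ge> 0"
    and simple: "\<And>i. i \<in> {1..k} \<Longrightarrow> order (\<mu> i) p = 1"
    and reflected: "\<And>i. i \<in> {1..k} \<Longrightarrow> \<mu> i > 0 \<Longrightarrow> poly p (- \<mu> i) \<noteq> 0"
    and odd_between: "\<And>i. i \<in> {1..<k} \<Longrightarrow> odd (zeros_on p {- \<mu> (i + 1)<..<- \<mu> i})"
    and outer: "k \<ge> 1 \<Longrightarrow> odd (zeros_on p {..<- \<mu> k}) \<longleftrightarrow> even (degree p)"

lemma gen_hurwitz_orderE:
  assumes "gen_hurwitz_order p k"
  obtains \<mu> where "gen_hurwitz_data p k \<mu>"
proof -
  obtain \<mu> where "lead_coeff p > 0" "strict_mono_on {1..k} \<mu>"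
    "{z. poly (cpoly p) z = 0 \<and> Re z \<ge> 0} = (\<lambda>i. complex_of_real (\<mu> i)) ` {1..k}"
    "\<forall>i\<in>{1..k}. \<mu> i \<ge> 0 \<and> order (\<mu> i) p = 1"
    "\<forall>i\<in>{1..k}. \<mu> i > 0 \<longrightarrow> poly p (- \<mu> i) \<noteq> 0"
    "\<forall>i\<in>{1..<k}. odd (zeros_on p {- \<mu> (i + 1)<..<- \<mu> i})"
    "k \<ge> 1 \<longrightarrow> (if even (degree p) then odd (zeros_on p {..<- \<mu> k})
            else even (zeros_on p {..<- \<mu> k}))"
    using assms unfolding gen_hurwitz_order_def by blast
  then have "gen_hurwitz_data p k \<mu>"
    by unfold_locales (auto split: if_splits)
  then show ?thesis by (rule that)
qed

context gen_hurwitz_data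
begin

lemma p_nonzero: "p \<noteq> 0"
  using lead by auto

lemma real_zeros: "{x. x \<ge> 0 \<and> poly p x = 0} = \<mu> ` {1..k}"
proof (intro equalityI subsetI)
  fix x assume "x \<in> {x. x \<ge> 0 \<and> poly p x = 0}"
  then have "complex_of_real x \<in> {z. poly (cpoly p) z = 0 \<and> Re z \<ge> 0}" by simp
  then show "x \<in> \<mu> ` {1..k}" unfolding closed_rhp by auto
next
  fix x assume "x \<in> \<mu> ` {1..k}"
  then have "complex_of_real x \<in> {z. poly (cpoly p) z = 0 \<and> Re z \<ge> 0}" unfolding closed_rhp by auto
  then show "x \<in> {x. x \<ge> 0 \<and> poly p x = 0}" by simp
qed

lemma mu_root: "i \<in> {1..k} \<Longrightarrow> poly p (\<mu> i) = 0"
  using real_zeros by blast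

lemma mu_less_iff: "i \<in> {1..k} \<Longrightarrow> j \<in> {1..k} \<Longrightarrow> \<mu> i < \<mu> j \<longleftrightarrow> i < j"
  using mono strict_mono_on_less by blast

lemma mu_zero_first: "i \<in> {1..k} \<Longrightarrow> \<mu> i = 0 \<Longrightarrow> i = 1"
  using mu_less_iff[of 1 i] nonneg[of 1] by (cases "i = 1") auto

lemma axis: "poly (cpoly p) z = 0 \<Longrightarrow> Re z = 0 \<Longrightarrow> z = 0"
proof -
  assume "poly (cpoly p) z = 0" "Re z = 0"
  then have "z \<in> (\<lambda>i. complex_of_real (\<mu> i)) ` {1..k}" unfolding closed_rhp[symmetric] by simp
  then show "z = 0" using \<open>Re z = 0\<close> by auto
qed

text \<open>
  A simple real zero of \<open>p\<close> is also a simple zero of its complexification, since differentiation commutes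
  with the embedding of coefficients. So no multiplicities enter the count.
\<close>

lemma size_closed_rhp: "size {#z \<in># proots (cpoly p). Re z \<ge> 0#} = k"
proof -
  have cp: "cpoly p \<noteq> 0" using p_nonzero by simp
  have ord: "order (complex_of_real (\<mu> i)) (cpoly p) = 1" if "i \<in> {1..k}" for i
  proof -
    have "poly (pderiv p) (\<mu> i) \<noteq> 0"
      using simple_root_iff_pderiv[OF p_nonzero mu_root[OF that]] simple[OF that] by blast
    then have "poly (pderiv (cpoly p)) (of_real (\<mu> i)) \<noteq> 0" by (simp add: cpoly_pderiv)
    then show ?thesis
      using simple_root_iff_pderiv[OF cp, of "of_real (\<mu> i)"] mu_root[OF that] by simp
  qed
  have inj: "inj_on (\<lambda>i. complex_of_real (\<mu> i)) {1..k}"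
    using strict_mono_on_imp_inj_on[OF mono] unfolding inj_on_def of_real_eq_iff .
  have set: "set_mset {#z \<in># proots (cpoly p). Re z \<ge> 0#} = (\<lambda>i. complex_of_real (\<mu> i)) ` {1..k}"
    using cp closed_rhp by auto
  have "size {#z \<in># proots (cpoly p). Re z \<ge> 0#} =
      (\<Sum>z\<in>(\<lambda>i. complex_of_real (\<mu> i)) ` {1..k}. count {#z \<in># proots (cpoly p). Re z \<ge> 0#} z)"
    unfolding size_multiset_overloaded_eq set ..
  also have "\<dots> = (\<Sum>z\<in>(\<lambda>i. complex_of_real (\<mu> i)) ` {1..k}. 1)"
    using cp ord nonneg by (intro sum.cong) auto
  also have "\<dots> = card ((\<lambda>i. complex_of_real (\<mu> i)) ` {1..k})" by simp
  also have "\<dots> = k" using inj by (simp add: card_image)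
  finally show ?thesis .
qed

text \<open>
  To the right of such an \<open>x\<close> lie exactly the simple zeros \<open>\<mu>\<^sub>j\<close> with \<open>j > i\<close>.
\<close>

lemma sgn_between:
  assumes i: "i \<in> {1..k}" and x: "\<mu> i < x" "i < k \<Longrightarrow> x < \<mu> (i + 1)"
  shows "sgn (poly p x) = (- 1) ^ (k - i)"
proof -
  have less: "x < \<mu> j \<longleftrightarrow> i < j" if j: "j \<in> {1..k}" for j
  proof
    assume "x < \<mu> j"
    then show "i < j" using x(1) mu_less_iff[OF i j] by linarith
  next
    assume "i < j"
    then have "\<mu> (i + 1) \<le> \<mu> j" "i < k"
      using mu_less_iff[of "i + 1" j] j i by (cases "j = i + 1"; force)+
    then show "x < \<mu> j" using x(2) by linarith
  qed
  have x0: "x \<ge> 0" using nonneg[OF i] x(1) by linarith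
  have "poly p x \<noteq> 0"
  proof
    assume "poly p x = 0"
    then obtain j where j: "j \<in> {1..k}" "x = \<mu> j" using real_zeros x0 by blast
    then show False using less[OF j(1)] mu_less_iff[OF i j(1)] x(1) by simp
  qed
  moreover have "zeros_on p {x<..} = k - i"
    by (rule zeros_on_right_of[OF p_nonzero mono real_zeros simple x0]) (use i less in auto)
  ultimately show ?thesis using sgn_poly_eq[of p x] lead by simp
qed

text \<open>
  Downward induction from \<open>i = k\<close>: the condition on \<open>(-\<infinity>, -\<mu>\<^sub>k)\<close> and the parity of the degree start it, and the odd
  number of zeros between \<open>-\<mu>\<^sub>i\<^sub>+\<^sub>1\<close> and \<open>-\<mu>\<^sub>i\<close> flips the parity in each step.
\<close>

lemma odd_zeros_right_of_reflected:
  assumes "i \<in> {1..k}"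
  shows "even (zeros_on p {- \<mu> i..}) \<longleftrightarrow> odd (k - i)"
  using assms
proof (induction "k - i" arbitrary: i)
  case 0
  then have [simp]: "i = k" and k: "k \<ge> 1" by auto
  have "UNIV = {..<- \<mu> k} \<union> {- \<mu> k..}" by auto
  then have "zeros_on p UNIV = zeros_on p {..<- \<mu> k} + zeros_on p {- \<mu> k..}"
    by (metis zeros_on_Un disjoint_iff atLeast_iff lessThan_iff not_le)
  then show ?case using even_degree_plus_zeros[OF p_nonzero] outer[OF k] by auto
next
  case (Suc d)
  then have i: "i \<in> {1..<k}" "i + 1 \<in> {1..k}" "i \<in> {1..k}" by auto
  have less: "\<mu> i < \<mu> (i + 1)" using mu_less_iff[OF i(3,2)] by simp
  then have "\<mu> (i + 1) > 0" using nonneg[OF i(3)] by linarith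
  then have "zeros_on p {- \<mu> (i + 1)..} = zeros_on p {- \<mu> (i + 1)<..<- \<mu> i} + zeros_on p {- \<mu> i..}"
    using zeros_on_atLeast_split[of "- \<mu> (i + 1)" "- \<mu> i" p] less reflected[OF i(2)] p_nonzero
    by (simp add: zeros_on_singleton_0)
  moreover have "even (zeros_on p {- \<mu> (i + 1)..}) \<longleftrightarrow> odd (k - (i + 1))"
    using Suc.hyps(2) i(2) by (intro Suc.hyps(1)) auto
  moreover have "k - i = Suc (k - (i + 1))" using i by auto
  ultimately show ?case using odd_between[OF i(1)] by auto
qed

lemma even_part_at_mu_square:
  assumes i: "i \<in> {1..k}" and pos: "\<mu> i > 0"
  shows "sgn (poly (even_part p) ((\<mu> i)\<^sup>2)) = - ((- 1) ^ (k - i))"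
proof -
  have "zeros_on p {- \<mu> i<..} = zeros_on p {- \<mu> i..}"
    using reflected[OF i pos] by (intro zeros_on_cong p_nonzero) (auto simp: order_less_le)
  then have "sgn (poly p (- \<mu> i)) = (- 1) ^ zeros_on p {- \<mu> i..}"
    using sgn_poly_eq[of p "- \<mu> i"] reflected[OF i pos] lead by simp
  also have "\<dots> = - ((- 1) ^ (k - i))"
    using odd_zeros_right_of_reflected[OF i] by (cases "even (k - i)") auto
  also have "poly p (- \<mu> i) = 2 * poly (even_part p) ((\<mu> i)\<^sup>2)"
    using mu_root[OF i] by (simp add: poly_even_part_square)
  finally show ?thesis by (simp add: sgn_mult)
qed

text \<open>
  The signs of \<open>e\<close> at \<open>\<mu>\<^sub>i\<^sup>2\<close> and at \<open>\<mu>\<^sub>i\<^sub>+\<^sub>1\<^sup>2\<close> (or at infinity, for the last interval) are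
  opposite, so \<open>e\<close> vanishes in between, at \<open>\<omega>\<close> say, and there \<open>p(\<surd>\<omega>) = \<surd>\<omega> f(\<omega>)\<close> has the known sign of \<open>p\<close> between
  its zeros. If \<open>\<mu>\<^sub>i = 0\<close>, then \<open>e\<close> vanishes at \<open>0\<close> already, and \<open>f(0) = p'(0)\<close>.
\<close>

lemma nonneg_zero_of_even_part:
  assumes i: "i \<in> {1..k}" and last: "i = k \<Longrightarrow> lead_coeff (even_part p) > 0"
  shows "\<exists>\<omega>\<ge>(\<mu> i)\<^sup>2. (i < k \<longrightarrow> \<omega> < (\<mu> (i + 1))\<^sup>2) \<and> poly (even_part p) \<omega> = 0 \<and>
    (- 1) ^ (k - i) * poly (odd_part p) \<omega> > 0"
proof (cases "\<mu> i = 0")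
  case True
  then have [simp]: "i = 1" using mu_zero_first[OF i] by simp
  have root: "poly p 0 = 0" using mu_root[OF i] True by simp
  have "order 0 p = 1" using simple[OF i] True by simp
  then have "sgn (poly (pderiv p) 0) = (- 1) ^ zeros_on p {0<..}"
    using sgn_pderiv_simple_root[OF p_nonzero root] lead by simp
  also have "zeros_on p {0<..} = k - 1"
    by (rule zeros_on_right_of[OF p_nonzero mono real_zeros simple])
      (use i True mu_less_iff[of 1] in auto)
  also have "poly (pderiv p) 0 = poly (odd_part p) 0"
    by (simp add: poly_0_coeff_0 coeff_pderiv coeff_odd_part)
  finally have "sgn (poly (odd_part p) 0) = (- 1) ^ (k - i)" by simp
  then have "(- 1) ^ (k - i) * poly (odd_part p) 0 > 0"
    by (cases "even (k - i)") (auto simp: sgn_if split: if_splits)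
  moreover have "poly (even_part p) 0 = 0" using root poly_even_odd[of p 0] by simp
  moreover have "0 < (\<mu> (i + 1))\<^sup>2" if "i < k"
    using mu_less_iff[of 1 2] that True by (simp add: numeral_2_eq_2)
  ultimately show ?thesis using True by (intro exI[of _ 0]) auto
next
  case False
  then have pos: "\<mu> i > 0" using nonneg[OF i] by simp
  have s: "sgn (poly (even_part p) ((\<mu> i)\<^sup>2)) = - ((- 1) ^ (k - i))"
    by (rule even_part_at_mu_square[OF i pos])
  have "\<exists>\<omega>>(\<mu> i)\<^sup>2. (i < k \<longrightarrow> \<omega> < (\<mu> (i + 1))\<^sup>2) \<and> poly (even_part p) \<omega> = 0"
  proof (cases "i = k")
    case True
    obtain Y where Y: "\<And>x. x \<ge> Y \<Longrightarrow> poly (even_part p) x > 0"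
      using poly_pinfty_gt_lc[of "even_part p"] last[OF True] by (meson less_le_trans)
    have "poly (even_part p) ((\<mu> i)\<^sup>2) < 0" using s True by (simp add: sgn_if split: if_splits)
    moreover have "poly (even_part p) (max Y ((\<mu> i)\<^sup>2 + 1)) > 0" by (rule Y) simp
    moreover have "(\<mu> i)\<^sup>2 < max Y ((\<mu> i)\<^sup>2 + 1)" by linarith
    ultimately have "\<exists>\<omega>>(\<mu> i)\<^sup>2. \<omega> < max Y ((\<mu> i)\<^sup>2 + 1) \<and> poly (even_part p) \<omega> = 0"
      by (intro poly_IVT_pos)
    then show ?thesis using True by blast
  next
    case False
    then have i1: "i + 1 \<in> {1..k}" and ik: "i < k" using i by auto
    have less: "\<mu> i < \<mu> (i + 1)" using mu_less_iff[OF i i1] by simp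
    have "sgn (poly (even_part p) ((\<mu> (i + 1))\<^sup>2)) = - ((- 1) ^ (k - (i + 1)))"
      using less pos by (intro even_part_at_mu_square i1) auto
    moreover have "k - i = Suc (k - (i + 1))" using ik by simp
    ultimately have "sgn (poly (even_part p) ((\<mu> i)\<^sup>2) * poly (even_part p) ((\<mu> (i + 1))\<^sup>2)) = - 1"
      using s by (simp add: sgn_mult flip: power_mult_distrib)
    then have "poly (even_part p) ((\<mu> i)\<^sup>2) * poly (even_part p) ((\<mu> (i + 1))\<^sup>2) < 0"
      by (subst sgn_less[symmetric]) linarith
    moreover have "(\<mu> i)\<^sup>2 < (\<mu> (i + 1))\<^sup>2" using less pos by (intro power_strict_mono) auto
    ultimately show ?thesis using poly_IVT[of "(\<mu> i)\<^sup>2" "(\<mu> (i + 1))\<^sup>2" "even_part p"] by auto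
  qed
  then obtain \<omega> where \<omega>: "\<omega> > (\<mu> i)\<^sup>2" "i < k \<longrightarrow> \<omega> < (\<mu> (i + 1))\<^sup>2" "poly (even_part p) \<omega> = 0" by blast
  define x where "x = sqrt \<omega>"
  have "\<omega> > 0" using \<omega>(1) by (meson le_less_trans zero_le_power2)
  then have x: "x > 0" "x\<^sup>2 = \<omega>" by (simp_all add: x_def)
  have "\<mu> i < x" using \<omega>(1) x by (metis less_imp_le power2_less_imp_less)
  moreover have "x < \<mu> (i + 1)" if "i < k"
  proof -
    have "\<mu> (i + 1) \<ge> 0" using nonneg[of "i + 1"] that by simp
    then show ?thesis using \<omega>(2) x that by (metis power2_less_imp_less)
  qed
  ultimately have "sgn (poly p x) = (- 1) ^ (k - i)" by (rule sgn_between[OF i])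
  moreover have "poly p x = x * poly (odd_part p) \<omega>" using poly_even_odd[of p x] \<omega>(3) x by simp
  ultimately have "sgn (poly (odd_part p) \<omega>) = (- 1) ^ (k - i)" using x(1) by (simp add: sgn_mult)
  then have "(- 1) ^ (k - i) * poly (odd_part p) \<omega> > 0"
    by (cases "even (k - i)") (auto simp: sgn_if split: if_splits)
  then show ?thesis using \<omega> by (intro exI[of _ \<omega>]) auto
qed

end

section \<open>Partial fractions with positive residues\<close>

text \<open>
  The product is the derivative of the monic polynomial with zeros \<open>x\<^sub>i\<close> at the zero \<open>x\<^sub>j\<close>, which has
  exactly \<open>j\<close> of the others above it.
\<close>

lemma prod_differences_sign:
  fixes x :: "nat \<Rightarrow> real"
  assumes dec: "\<And>i j. i < j \<Longrightarrow> j < D \<Longrightarrow> x j < x i" and j: "j < D"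
  shows "(- 1) ^ j * (\<Prod>i\<in>{..<D} - {j}. x j - x i) > 0"
proof -
  have split: "{..<D} - {j} = {..<j} \<union> {j<..<D}" using j by auto
  have "(\<Prod>i\<in>{..<D} - {j}. x j - x i) = (\<Prod>i<j. x j - x i) * (\<Prod>i\<in>{j<..<D}. x j - x i)"
    unfolding split by (rule prod.union_disjoint) auto
  also have "(- 1) ^ j * \<dots> = ((- 1) ^ j * (\<Prod>i<j. x j - x i)) * (\<Prod>i\<in>{j<..<D}. x j - x i)"
    by (rule mult.assoc[symmetric])
  also have "(- 1) ^ j * (\<Prod>i<j. x j - x i) = (\<Prod>i<j. x i - x j)"
    using prod.distrib[of "\<lambda>_. - 1" "\<lambda>i. x j - x i" "{..<j}"] by simp
  finally have "(- 1) ^ j * (\<Prod>i\<in>{..<D} - {j}. x j - x i) =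
    (\<Prod>i<j. x i - x j) * (\<Prod>i\<in>{j<..<D}. x j - x i)" .
  moreover have "(\<Prod>i<j. x i - x j) > 0" "(\<Prod>i\<in>{j<..<D}. x j - x i) > 0"
    using dec j by (auto intro!: prod_pos)
  then have "(\<Prod>i<j. x i - x j) * (\<Prod>i\<in>{j<..<D}. x j - x i) > 0" by (rule mult_pos_pos)
  ultimately show ?thesis by simp
qed

text \<open>
  Lagrange interpolation at the zeros of \<open>q\<close> expands \<open>r/q\<close> as \<open>c u + \<beta> + \<Sum>\<^sub>j \<gamma>\<^sub>j/(u - x\<^sub>j)\<close>. The
  alternation of \<open>r\<close> matches that of \<open>q'\<close>, so all residues are positive, and the condition on the top
  coefficient says \<open>c \<le> 0\<close>. Every nonconstant term then maps the upper half-plane to the lower one.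
\<close>

lemma alternating_imp_Im_neg:
  fixes q r :: "real poly" and x :: "nat \<Rightarrow> real"
  assumes q: "degree q = D" "q \<noteq> 0"
    and dec: "\<And>i j. i < j \<Longrightarrow> j < D \<Longrightarrow> x j < x i"
    and roots: "\<And>j. j < D \<Longrightarrow> poly q (x j) = 0"
    and sign: "\<And>j. j < D \<Longrightarrow> lead_coeff q * ((- 1) ^ j * poly r (x j)) > 0"
    and deg: "degree r \<le> D + 1" and top: "lead_coeff q * coeff r (D + 1) \<le> 0"
    and nontriv: "D = 0 \<Longrightarrow> coeff r (D + 1) \<noteq> 0"
    and z: "Im z > 0"
  shows "poly (cpoly q) z \<noteq> 0" "Im (poly (cpoly r) z / poly (cpoly q) z) < 0"
proof -
  define lc where "lc = lead_coeff q"
  have lc: "lc \<noteq> 0" using q(2) by (simp add: lc_def)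
  have inj: "inj_on (\<lambda>i. complex_of_real (x i)) {..<D}"
  proof (rule inj_onI)
    fix i j assume "i \<in> {..<D}" "j \<in> {..<D}" "complex_of_real (x i) = complex_of_real (x j)"
    then show "i = j" using dec[of i j] dec[of j i] by (cases i j rule: linorder_cases) auto
  qed
  define X where "X = (\<lambda>i. complex_of_real (x i)) ` {..<D}"
  have cardX: "card X = D" using inj by (simp add: X_def card_image)
  have deg_prod: "degree (\<Prod>i\<in>I. [:- complex_of_real (x i), 1:]) = card I" for I
    by (subst degree_prod_eq_sum_degree) auto
  have "cpoly q = smult (of_real lc) (\<Prod>i<D. [:- complex_of_real (x i), 1:])"
  proof (rule poly_eqI_degree_lead_coeff[where A = X and n = D])
    show "degree (smult (complex_of_real lc) (\<Prod>i<D. [:- complex_of_real (x i), 1:])) \<le> D"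
      using lc by (simp add: deg_prod)
    have "lead_coeff (\<Prod>i<D. [:- complex_of_real (x i), 1:]) = 1" by (simp add: lead_coeff_prod)
    then show "poly.coeff (cpoly q) D = poly.coeff (smult (of_real lc) (\<Prod>i<D. [:- complex_of_real (x i), 1:])) D"
      using q by (simp add: lc_def deg_prod)
    fix u assume "u \<in> X"
    then obtain j where j: "j < D" "u = of_real (x j)" by (auto simp: X_def)
    then show "poly (cpoly q) u = poly (smult (of_real lc) (\<Prod>i<D. [:- complex_of_real (x i), 1:])) u"
      using roots[OF j(1)] by (auto simp: poly_prod)
  qed (use cardX q in auto)
  then have qz: "poly (cpoly q) z = of_real lc * (\<Prod>i<D. z - of_real (x i))"
    by (simp add: poly_prod)
  have zx: "z - of_real a \<noteq> 0" for a using z by (auto simp: complex_eq_iff)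
  show nz: "poly (cpoly q) z \<noteq> 0" using lc zx by (simp add: qz)

  \<comment> \<open>Subtracting the polynomial part \<open>c u + \<beta>\<close> of the quotient leaves a numerator of degree less than \<open>D\<close>.\<close>
  define c where "c = coeff r (D + 1) / lc"
  define r1 where "r1 = r - smult c (pCons 0 q)"
  define \<beta> where "\<beta> = coeff r1 D / lc"
  define r2 where "r2 = r1 - smult \<beta> q"
  have coeffs: "coeff r2 i = 0" if "i \<ge> D" for i
  proof -
    consider "i = D" | "i = D + 1" | "i > D + 1" using \<open>i \<ge> D\<close> by linarith
    then show ?thesis
    proof cases
      case 1
      then show ?thesis using lc q by (simp add: r2_def \<beta>_def lc_def)
    next
      case 2
      then show ?thesis using lc q by (simp add: r2_def r1_def c_def lc_def coeff_eq_0)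
    next
      case 3
      then show ?thesis using deg q by (cases i) (simp_all add: r2_def r1_def coeff_eq_0)
    qed
  qed
  define \<gamma> where "\<gamma> = (\<lambda>j. poly r (x j) / (\<Prod>i\<in>{..<D} - {j}. x j - x i))"
  have \<gamma>: "\<gamma> j / lc > 0" if j: "j < D" for j
  proof -
    let ?P = "\<Prod>i\<in>{..<D} - {j}. x j - x i"
    have P: "(- 1) ^ j * ?P > 0" by (intro prod_differences_sign dec j)
    have "a / b / l > 0" if "l * (s * a) > 0" "s * b > 0" for a b l s :: real
      using that by (auto simp: zero_less_divide_iff zero_less_mult_iff mult_less_0_iff)
    from this[OF sign[OF j] P] show ?thesis by (simp only: \<gamma>_def lc_def)
  qed
  define G where "G = (\<Sum>j<D. smult (of_real (\<gamma> j)) (\<Prod>i\<in>{..<D} - {j}. [:- complex_of_real (x i), 1:]))"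
  have "cpoly r2 = G"
  proof (cases "D = 0")
    case True
    then have "r2 = 0" using coeffs by (intro poly_eqI) auto
    then show ?thesis using True by (simp add: G_def)
  next
    case False
    show ?thesis
    proof (rule poly_eqI_degree[where A = X])
      have "degree r2 \<le> D - 1" using coeffs by (intro degree_le) auto
      then show "degree (cpoly r2) < card X" using False cardX by simp
      have "degree G \<le> D - 1"
        unfolding G_def
        by (intro degree_sum_le order.trans[OF degree_smult_le]) (auto simp: deg_prod)
      then show "degree G < card X" using False cardX by simp
      fix u assume "u \<in> X"
      then obtain k where k: "k < D" "u = of_real (x k)" by (auto simp: X_def)
      have "poly G u = (\<Sum>j<D. of_real (\<gamma> j) * (\<Prod>i\<in>{..<D} - {j}. of_real (x k) - of_real (x i)))"
        by (simp add: G_def poly_sum poly_prod k)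
      also have "\<dots> = (\<Sum>j<D. if j = k then of_real (poly r (x k)) else 0)"
      proof (rule sum.cong[OF refl])
        fix j assume j: "j \<in> {..<D}"
        have "(\<Prod>i\<in>{..<D} - {j}. complex_of_real (x k) - of_real (x i)) = 0" if "j \<noteq> k"
          using that k by (intro prod_zero) auto
        moreover have "(- 1) ^ k * (\<Prod>i\<in>{..<D} - {k}. x k - x i) > 0"
          by (intro prod_differences_sign dec k(1))
        then have "(\<Prod>i\<in>{..<D} - {k}. x k - x i) \<noteq> 0" by (metis mult_zero_right less_irrefl)
        then have "of_real (\<gamma> k) * (\<Prod>i\<in>{..<D} - {k}. complex_of_real (x k) - of_real (x i)) =
            of_real (poly r (x k))"
          unfolding \<gamma>_def of_real_diff[symmetric] of_real_prod[symmetric] of_real_mult[symmetric]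
          by simp
        ultimately show "of_real (\<gamma> j) * (\<Prod>i\<in>{..<D} - {j}. of_real (x k) - of_real (x i)) =
            (if j = k then complex_of_real (poly r (x k)) else 0)" by auto
      qed
      also have "\<dots> = of_real (poly r (x k))" using k by simp
      also have "\<dots> = poly (cpoly r2) u"
        using roots[OF k(1)] by (simp add: r2_def r1_def k)
      finally show "poly (cpoly r2) u = poly G u" ..
    qed
  qed
  have "cpoly r = cpoly r2 + smult (of_real \<beta>) (cpoly q) + smult (of_real c) (pCons 0 (cpoly q))"
    by (rule poly_eqI) (simp add: r2_def r1_def coeff_pCons split: nat.split)
  then have "poly (cpoly r) z = poly (cpoly r2) z + of_real \<beta> * poly (cpoly q) z + of_real c * (z * poly (cpoly q) z)"
    by simp
  also have "poly (cpoly r2) z = (\<Sum>j<D. of_real (\<gamma> j) * (\<Prod>i\<in>{..<D} - {j}. z - of_real (x i)))"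
    unfolding \<open>cpoly r2 = G\<close> by (simp add: G_def poly_sum poly_prod)
  finally have "poly (cpoly r) z / poly (cpoly q) z =
      (\<Sum>j<D. of_real (\<gamma> j) * (\<Prod>i\<in>{..<D} - {j}. z - of_real (x i)) / poly (cpoly q) z) + of_real \<beta> + of_real c * z"
    using nz by (simp add: add_divide_distrib sum_divide_distrib)
  also have "(\<Sum>j<D. of_real (\<gamma> j) * (\<Prod>i\<in>{..<D} - {j}. z - of_real (x i)) / poly (cpoly q) z) =
      (\<Sum>j<D. of_real (\<gamma> j / lc) / (z - of_real (x j)))"
  proof (rule sum.cong[OF refl])
    fix j assume "j \<in> {..<D}"
    then have split: "(\<Prod>i<D. z - of_real (x i)) = (z - of_real (x j)) * (\<Prod>i\<in>{..<D} - {j}. z - of_real (x i))"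
      by (subst prod.remove[of _ j]) auto
    moreover have "(\<Prod>i\<in>{..<D} - {j}. z - of_real (x i)) \<noteq> 0" using zx by simp
    ultimately show "of_real (\<gamma> j) * (\<Prod>i\<in>{..<D} - {j}. z - of_real (x i)) / poly (cpoly q) z =
        of_real (\<gamma> j / lc) / (z - of_real (x j))"
      unfolding qz split by (simp add: of_real_divide)
  qed
  finally have eq: "poly (cpoly r) z / poly (cpoly q) z =
    (\<Sum>j<D. of_real (\<gamma> j / lc) / (z - of_real (x j))) + of_real \<beta> + of_real c * z" .
  have Im_inverse: "Im (of_real g / (z - of_real a)) < 0" if "g > 0" for g a
  proof -
    have "(Re z - a)\<^sup>2 + (Im z)\<^sup>2 > 0" using z by (simp add: sum_power2_gt_zero_iff)
    then show ?thesis using mult_pos_pos[OF that z] by (simp add: Im_divide divide_less_0_iff)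
  qed
  have neg: "Im (of_real (\<gamma> j / lc) / (z - of_real (x j))) < 0" if "j < D" for j
    by (rule Im_inverse) (rule \<gamma>[OF that])
  have c: "c \<le> 0"
  proof -
    have "lc * coeff r (D + 1) / lc\<^sup>2 \<le> 0" using top by (simp add: lc_def divide_le_0_iff)
    then show ?thesis using lc by (simp add: c_def power2_eq_square)
  qed
  have "Im (poly (cpoly r) z / poly (cpoly q) z) =
      (\<Sum>j<D. Im (of_real (\<gamma> j / lc) / (z - of_real (x j)))) + c * Im z"
    unfolding eq by (simp add: Im_sum)
  also have "\<dots> < 0"
  proof (cases "D = 0")
    case True
    then have "c < 0" using c lc nontriv by (auto simp: c_def order_less_le)
    then show ?thesis using True z by (simp add: mult_neg_pos)
  next
    case False
    have "(\<Sum>j<D. Im (of_real (\<gamma> j / lc) / (z - of_real (x j)))) < (\<Sum>j<D. 0)"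
      by (rule sum_strict_mono) (use neg False in auto)
    moreover have "c * Im z \<le> 0" using c z by (intro mult_nonpos_nonneg) auto
    ultimately show ?thesis by simp
  qed
  finally show "Im (poly (cpoly r) z / poly (cpoly q) z) < 0" .
qed

text \<open>
  The alternation makes \<open>f\<close> nonzero at all zeros of \<open>e\<close>, so none of these is cancelled. The assumption of the
  first conclusion excludes a constant quotient.
\<close>

lemma alternating_imp_R_function:
  fixes p :: "real poly" and x :: "nat \<Rightarrow> real"
  defines "e \<equiv> even_part p" and "f \<equiv> odd_part p"
  assumes e: "degree e = D" "e \<noteq> 0"
    and dec: "\<And>i j. i < j \<Longrightarrow> j < D \<Longrightarrow> x j < x i"
    and roots: "\<And>j. j < D \<Longrightarrow> poly e (x j) = 0"
    and sign: "\<And>j. j < D \<Longrightarrow> lead_coeff e * ((- 1) ^ j * poly f (x j)) > 0"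
    and deg: "degree f \<le> D + 1" and top: "lead_coeff e * coeff f (D + 1) \<le> 0"
  shows "D \<ge> 1 \<or> coeff f (D + 1) \<noteq> 0 \<Longrightarrow> R_function (assoc_fun p)"
    and "{u. is_pole (assoc_fun p) u} = (\<lambda>j. complex_of_real (x j)) ` {..<D}"
    and "inj_on (\<lambda>j. complex_of_real (x j)) {..<D}"
proof -
  show inj: "inj_on (\<lambda>j. complex_of_real (x j)) {..<D}"
  proof (rule inj_onI)
    fix i j assume "i \<in> {..<D}" "j \<in> {..<D}" "complex_of_real (x i) = complex_of_real (x j)"
    then show "i = j" using dec[of i j] dec[of j i] by (cases i j rule: linorder_cases) auto
  qed
  have ce: "cpoly e \<noteq> 0" using e by simp
  have sub: "(\<lambda>j. complex_of_real (x j)) ` {..<D} \<subseteq> {u. poly (cpoly e) u = 0}"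
    using roots by auto
  have "card {u. poly (cpoly e) u = 0} \<le> D"
    using card_poly_roots_bound[OF ce] e by simp
  then have eq: "(\<lambda>j. complex_of_real (x j)) ` {..<D} = {u. poly (cpoly e) u = 0}"
    using inj sub by (intro card_seteq poly_roots_finite ce) (auto simp: card_image)
  have "is_pole (assoc_fun p) u \<longleftrightarrow> poly (cpoly e) u = 0" for u
  proof
    assume "is_pole (assoc_fun p) u"
    then show "poly (cpoly e) u = 0"
      using is_pole_assoc_fun_iff[of p u] e(2) rational_not_pole(1) unfolding e_def by blast
  next
    assume u: "poly (cpoly e) u = 0"
    then obtain j where j: "j < D" "u = of_real (x j)" using eq by blast
    then have "poly (cpoly f) u \<noteq> 0" using sign[OF j(1)] by auto
    then show "is_pole (assoc_fun p) u"
      using is_pole_assoc_fun_iff[of p u] e(2) rational_pole[OF ce u] unfolding e_def f_def by blast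
  qed
  then show "{u. is_pole (assoc_fun p) u} = (\<lambda>j. complex_of_real (x j)) ` {..<D}" using eq by auto
  show "R_function (assoc_fun p)" if nontriv: "D \<ge> 1 \<or> coeff f (D + 1) \<noteq> 0"
    unfolding R_function_def
  proof (intro conjI allI impI)
    show "rational_fun (assoc_fun p)"
      unfolding rational_fun_def assoc_fun_def using ce unfolding e_def by blast
    fix z :: complex assume z: "Im z > 0"
    have nt: "D = 0 \<Longrightarrow> coeff f (D + 1) \<noteq> 0" using nontriv by auto
    note im = alternating_imp_Im_neg[OF e dec roots sign deg top nt z]
    show "\<not> is_pole (assoc_fun p) z"
      using is_pole_assoc_fun_iff[of p z] e(2) rational_not_pole(1) im(1) unfolding e_def by blast
    show "Im (assoc_fun p z) < 0"
      using assoc_fun_eq[of p z] im unfolding e_def f_def by simp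
  qed
qed

section \<open>Interlacing zeros of the even and odd parts\<close>

context gen_hurwitz_data
begin

text \<open>
  The hypothesis leaves at most a simple zero at the origin outside the open left half-plane. These are
  the polynomials for which the condition \<open>a\<^sub>1 \<le> 0\<close>, and with it the count \<open>k - 1\<close>, cannot occur.
\<close>

lemma second_coeff_pos_if_left:
  assumes n: "degree p \<ge> 2" and left: "\<And>i. i \<in> {1..k} \<Longrightarrow> \<mu> i = 0"
  shows "coeff p (degree p - 1) > 0"
proof -
  have le: "Re z \<le> 0" if "poly (cpoly p) z = 0" for z
  proof (rule ccontr)
    assume "\<not> Re z \<le> 0"
    then have "z \<in> (\<lambda>i. complex_of_real (\<mu> i)) ` {1..k}"
      unfolding closed_rhp[symmetric] using that by simp
    then show False using left \<open>\<not> Re z \<le> 0\<close> by auto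
  qed
  have "k \<le> 1"
  proof (rule ccontr)
    assume "\<not> k \<le> 1"
    then have "\<mu> 1 < \<mu> 2" using mu_less_iff[of 1 2] by simp
    then show False using left[of 1] left[of 2] \<open>\<not> k \<le> 1\<close> by simp
  qed
  have "size (proots (cpoly p)) = degree p" by (simp add: size_proots_complex)
  then have "{#z \<in># proots (cpoly p). Re z \<ge> 0#} \<noteq> proots (cpoly p)"
    using size_closed_rhp \<open>k \<le> 1\<close> n by auto
  then obtain w where "w \<in># proots (cpoly p)" "\<not> Re w \<ge> 0"
    by (metis filter_mset_True filter_mset_cong)
  then have "poly (cpoly p) w = 0" "Re w < 0" using p_nonzero by auto
  then show ?thesis using second_coeff_pos[OF lead le] by blast
qed

text \<open>
  The \<open>K\<close> zeros from the nonnegative half-axis and the \<open>D - K\<close> zeros from the imaginary axis are \<open>D\<close> distinct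
  zeros of \<open>e\<close>, whose degree is at most \<open>D\<close>; so there are no others, and the degree is \<open>D\<close>. For the last interval
  \<open>(\<mu>\<^sub>k\<^sup>2, \<infinity>)\<close> to contribute, \<open>e\<close> must be positive at infinity, which accounts for the two cases
  in \<open>K\<close>. When it does not contribute, \<open>e\<close> keeps its negative sign from \<open>\<mu>\<^sub>k\<^sup>2\<close> on, so its leading
  coefficient is negative and the alternation starts with the opposite sign.
\<close>

lemma even_part_interlacing_zeros:
  defines "n \<equiv> degree p" and "a1 \<equiv> coeff p (degree p - 1)"
  defines "l \<equiv> n div 2"
  defines "K \<equiv> (if even n \<or> a1 > 0 then k else k - 1)"
  defines "D \<equiv> (if even n \<or> a1 \<noteq> 0 then l else l - 1)"
  assumes n: "n \<ge> 2"
  shows "degree (even_part p) = D" "even_part p \<noteq> 0" "K \<le> k" "k \<le> Suc K" "K < k \<longleftrightarrow> odd n \<and> a1 \<le> 0"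
    "lead_coeff (even_part p) * (- 1) ^ (k - K) > 0"
    "\<exists>x. (\<forall>i j. i < j \<longrightarrow> j < D \<longrightarrow> x j < x i) \<and> K \<le> D \<and>
      (\<forall>j<D. poly (even_part p) (x j) = 0 \<and> (- 1) ^ (k - K + j) * poly (odd_part p) (x j) > 0 \<and>
        (x j \<ge> 0 \<longleftrightarrow> j < K))"
proof -
  let ?e = "even_part p" and ?f = "odd_part p"
  have nl: "n = 2 * l \<or> n = 2 * l + 1" unfolding l_def by presburger
  have even_n: "even n \<longleftrightarrow> n = 2 * l" using nl by auto
  have l: "l \<ge> 1" using n l_def by auto
  have vieta: "a1 > 0" if "\<And>i. i \<in> {1..k} \<Longrightarrow> \<mu> i = 0"
    unfolding a1_def using second_coeff_pos_if_left n that unfolding n_def by blast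
  have k_pos: "k \<ge> 1" "\<mu> k > 0" if "a1 \<le> 0"
  proof -
    have "\<not> (\<forall>i\<in>{1..k}. \<mu> i = 0)" using vieta that by (meson not_le)
    then obtain i where i: "i \<in> {1..k}" "\<mu> i \<noteq> 0" by blast
    then show "k \<ge> 1" by auto
    have "\<mu> i \<le> \<mu> k" using mu_less_iff[of i k] i(1) by (cases "i = k") auto
    then show "\<mu> k > 0" using nonneg[OF i(1)] i(2) by linarith
  qed
  show Kk: "K \<le> k" "k \<le> Suc K" by (auto simp: K_def)
  show K_less: "K < k \<longleftrightarrow> odd n \<and> a1 \<le> 0" using k_pos(1) by (auto simp: K_def)
  have coeff_even: "coeff ?e l = (if even n then lead_coeff p else a1)"
    using nl even_n unfolding coeff_even_part a1_def n_def by auto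
  \<comment> \<open>An odd polynomial has its zeros in opposite pairs, against the condition on \<open>-\<mu>\<^sub>k\<close>.\<close>
  have e0: "?e \<noteq> 0"
  proof
    assume e: "?e = 0"
    then have "odd n" "a1 = 0" using coeff_even lead by (auto split: if_splits)
    then have "\<mu> k > 0" "k \<in> {1..k}" using k_pos by auto
    then show False using even_part_at_mu_square[of k] e by simp
  qed
  show "?e \<noteq> 0" by (rule e0)
  have deg_le: "degree ?e \<le> D"
  proof (rule degree_le, intro allI impI)
    fix i assume "D < i"
    then consider "i > l" | "i = l" "odd n" "a1 = 0" unfolding D_def by (auto split: if_splits) linarith
    then show "coeff ?e i = 0"
    proof cases
      case 1
      then show ?thesis using nl unfolding coeff_even_part n_def by (intro coeff_eq_0) auto
    qed (simp add: coeff_even)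
  qed
  have roots_le: "card S \<le> degree ?e" if "\<And>x. x \<in> S \<Longrightarrow> poly ?e x = 0" for S
  proof -
    have "card S \<le> card {x. poly ?e x = 0}" using that by (intro card_mono poly_roots_finite e0) auto
    also have "\<dots> \<le> degree ?e" by (rule card_poly_roots_bound[OF e0])
    finally show ?thesis .
  qed
  have lead_e: "lead_coeff ?e > 0" if "K = k" "k \<ge> 1"
  proof -
    have "coeff ?e l > 0" using K_less that lead unfolding coeff_even by auto
    moreover from this have "degree ?e = l" using deg_le le_degree[of ?e l] unfolding D_def by (auto split: if_splits)
    ultimately show ?thesis by simp
  qed
  have "\<exists>\<omega>\<ge>(\<mu> i)\<^sup>2. (i < k \<longrightarrow> \<omega> < (\<mu> (i + 1))\<^sup>2) \<and> poly ?e \<omega> = 0 \<and> (- 1) ^ (k - i) * poly ?f \<omega> > 0"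
    if "i \<in> {1..K}" for i
    using that Kk lead_e by (intro nonneg_zero_of_even_part) auto
  then obtain \<omega> where \<omega>: "\<And>i. i \<in> {1..K} \<Longrightarrow> (\<mu> i)\<^sup>2 \<le> \<omega> i \<and> (i < k \<longrightarrow> \<omega> i < (\<mu> (i + 1))\<^sup>2) \<and>
      poly ?e (\<omega> i) = 0 \<and> (- 1) ^ (k - i) * poly ?f (\<omega> i) > 0"
    by metis
  have \<omega>_nonneg: "\<omega> i \<ge> 0" if "i \<in> {1..K}" for i
    using \<omega>[OF that] by (meson order_trans zero_le_power2)
  have \<omega>_less: "\<omega> i < \<omega> j" if "i \<in> {1..K}" "j \<in> {1..K}" "i < j" for i j
  proof -
    have "\<omega> i < (\<mu> (i + 1))\<^sup>2" using \<omega>[OF that(1)] that Kk by auto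
    also have "\<mu> (i + 1) \<le> \<mu> j"
      using mu_less_iff[of "i + 1" j] that Kk by (cases "j = i + 1") auto
    then have "(\<mu> (i + 1))\<^sup>2 \<le> (\<mu> j)\<^sup>2" using nonneg[of "i + 1"] that Kk by (intro power_mono) auto
    also have "\<dots> \<le> \<omega> j" using \<omega>[OF that(2)] by blast
    finally show ?thesis .
  qed
  have "K \<le> D"
  proof -
    have "inj_on \<omega> {1..K}"
      by (intro linorder_inj_onI) (use \<omega>_less in force)+
    then have "K = card (\<omega> ` {1..K})" by (simp add: card_image)
    also have "\<dots> \<le> degree ?e" using \<omega> by (intro roots_le) auto
    finally show ?thesis using deg_le by simp
  qed
  \<comment> \<open>The remaining zeros have to come from the negative half-axis.\<close>
  define m where "m = D - K"
  have "2 * (k + m) \<le> n \<or> 2 * (k + m) = n + 1 \<and> a1 < 0"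
  proof (cases "even n \<or> a1 > 0")
    case True
    then have "k + m = l" using \<open>K \<le> D\<close> by (auto simp: m_def K_def D_def)
    then show ?thesis using nl by auto
  next
    case False
    then have odd_case: "K = k - 1" "k \<ge> 1" "D = (if a1 < 0 then l else l - 1)" "n = 2 * l + 1"
      using k_pos even_n nl by (auto simp: K_def D_def)
    then have "k + m = (if a1 < 0 then l + 1 else l)" using \<open>K \<le> D\<close> l by (auto simp: m_def)
    then show ?thesis using odd_case(4) by (auto split: if_splits)
  qed
  then obtain y where y: "strict_mono_on {..<m} y" "\<forall>j<m. y j > 0 \<and> poly ?e (- (y j)\<^sup>2) = 0 \<and>
      (- 1) ^ (k + j) * poly ?f (- (y j)\<^sup>2) > 0"
    using negative_zeros[OF lead axis size_closed_rhp[symmetric], of m] unfolding a1_def n_def by blast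
  \<comment> \<open>Zeros in decreasing order: the \<open>\<omega>\<^sub>i\<close> increase with \<open>i\<close>, the \<open>-y\<^sub>j\<^sup>2\<close> decrease with \<open>j\<close>.\<close>
  define x where "x = (\<lambda>j. if j < K then \<omega> (K - j) else - (y (j - K))\<^sup>2)"
  have x_props: "poly ?e (x j) = 0 \<and> (- 1) ^ (k - K + j) * poly ?f (x j) > 0 \<and> (x j \<ge> 0 \<longleftrightarrow> j < K)"
    if j: "j < D" for j
  proof (cases "j < K")
    case True
    then have i: "K - j \<in> {1..K}" by auto
    have "k - (K - j) = k - K + j" using True Kk by auto
    then show ?thesis using \<omega>[OF i] \<omega>_nonneg[OF i] True by (simp add: x_def)
  next
    case False
    then have jm: "j - K < m" using j by (simp add: m_def)
    moreover have "(- 1) ^ (k + (j - K)) = ((- 1) ^ (k - K + j) :: real)"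
    proof -
      have "even (k + (j - K)) \<longleftrightarrow> even (k - K + j)" using False Kk by presburger
      then show ?thesis by (cases "even (k - K + j)") auto
    qed
    moreover have yj: "y (j - K) > 0" "poly ?e (- (y (j - K))\<^sup>2) = 0"
      "(- 1) ^ (k + (j - K)) * poly ?f (- (y (j - K))\<^sup>2) > 0"
      using y(2) jm by auto
    moreover have "x j = - (y (j - K))\<^sup>2" using False by (simp add: x_def)
    moreover have "- (y (j - K))\<^sup>2 < 0" using yj(1) by simp
    ultimately show ?thesis using False by auto
  qed
  have x_dec: "x j < x i" if "i < j" "j < D" for i j
  proof -
    consider "j < K" | "i < K" "\<not> j < K" | "\<not> i < K" using \<open>i < j\<close> by linarith
    then show ?thesis
    proof cases
      case 1
      then show ?thesis using \<omega>_less[of "K - j" "K - i"] that by (simp add: x_def)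
    next
      case 2
      then show ?thesis using x_props[of i] x_props[of j] that by fastforce
    next
      case 3
      then have "y (i - K) < y (j - K)" "y (i - K) > 0"
        using y that strict_mono_onD[OF y(1), of "i - K" "j - K"] by (auto simp: m_def)
      then have "(y (i - K))\<^sup>2 < (y (j - K))\<^sup>2" by (intro power_strict_mono) auto
      then show ?thesis using 3 that by (simp add: x_def)
    qed
  qed
  have inj: "inj_on x {..<D}"
  proof (rule inj_onI)
    fix i j assume "i \<in> {..<D}" "j \<in> {..<D}" "x i = x j"
    then show "i = j" using x_dec[of i j] x_dec[of j i] by (cases i j rule: linorder_cases) auto
  qed
  have "D = card (x ` {..<D})" using inj by (simp add: card_image)
  also have "\<dots> \<le> degree ?e" using x_props by (intro roots_le) auto
  finally show deg: "degree ?e = D" using deg_le by simp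
  have "finite {u. poly ?e u = 0}" by (rule poly_roots_finite[OF e0])
  moreover have "x ` {..<D} \<subseteq> {u. poly ?e u = 0}" using x_props by auto
  moreover have "card {u. poly ?e u = 0} \<le> card (x ` {..<D})"
    using card_poly_roots_bound[OF e0] inj by (simp add: card_image deg)
  ultimately have roots_eq: "{u. poly ?e u = 0} = x ` {..<D}" using card_seteq by metis
  show "lead_coeff ?e * (- 1) ^ (k - K) > 0"
  proof (cases "K < k")
    case False
    then have "K = k" using Kk by simp
    moreover have "lead_coeff ?e > 0"
    proof -
      have "coeff ?e l > 0" using K_less False lead unfolding coeff_even by auto
      moreover have "degree ?e = l" using K_less False deg unfolding D_def by auto
      ultimately show ?thesis by simp
    qed
    ultimately show ?thesis by simp
  next
    case True
    then have "k - K = 1" using Kk by simp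
    have "odd n" "a1 \<le> 0" using True K_less by auto
    then have k: "k \<in> {1..k}" "\<mu> k > 0" using k_pos by auto
    have neg: "poly ?e ((\<mu> k)\<^sup>2) < 0"
      using even_part_at_mu_square[OF k] by (simp add: sgn_if split: if_splits)
    have "x j < (\<mu> k)\<^sup>2" if "j < D" for j
    proof (cases "j < K")
      case j: True
      then have i: "K - j \<in> {1..K}" "K - j < k" using \<open>K < k\<close> by auto
      have "\<omega> (K - j) < (\<mu> (K - j + 1))\<^sup>2" using \<omega>[OF i(1)] i(2) by blast
      also have "\<mu> (K - j + 1) \<le> \<mu> k"
        using mu_less_iff[of "K - j + 1" k] i k by (cases "K - j + 1 = k") auto
      then have "(\<mu> (K - j + 1))\<^sup>2 \<le> (\<mu> k)\<^sup>2" using nonneg[of "K - j + 1"] i by (intro power_mono) auto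
      finally show ?thesis using j by (simp add: x_def)
    next
      case False
      then have "x j < 0" using x_props[OF that] by auto
      also have "0 < (\<mu> k)\<^sup>2" using k(2) by simp
      finally show ?thesis .
    qed
    then have "\<not> (\<exists>u\<in>{(\<mu> k)\<^sup>2<..}. poly ?e u = 0)" using roots_eq by force
    then have "zeros_on ?e {(\<mu> k)\<^sup>2<..} = 0" using zeros_on_pos_iff[OF e0] by blast
    then have "sgn (poly ?e ((\<mu> k)\<^sup>2)) = sgn (lead_coeff ?e)"
      using sgn_poly_eq[of ?e "(\<mu> k)\<^sup>2"] neg by simp
    then have "lead_coeff ?e < 0" using neg by (metis sgn_less)
    then show ?thesis using \<open>k - K = 1\<close> by simp
  qed
  show "\<exists>x. (\<forall>i j. i < j \<longrightarrow> j < D \<longrightarrow> x j < x i) \<and> K \<le> D \<and>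
      (\<forall>j<D. poly ?e (x j) = 0 \<and> (- 1) ^ (k - K + j) * poly ?f (x j) > 0 \<and> (x j \<ge> 0 \<longleftrightarrow> j < K))"
    using x_dec x_props \<open>K \<le> D\<close> by blast
qed

end

section \<open>The equivalence\<close>

text \<open>
  Only for odd degree with \<open>a\<^sub>1 = 0\<close> does the degree of \<open>f\<close> exceed that of \<open>e\<close>. Then \<open>\<Phi>\<close> has a pole at infinity, and
  the negative leading coefficient of \<open>e\<close> gives its linear term the sign required of an R-function.
\<close>

lemma gen_hurwitz_order_imp_R_function:
  fixes p :: "real poly"
  defines "n \<equiv> degree p" and "a1 \<equiv> coeff p (degree p - 1)"
  assumes gh: "gen_hurwitz_order p k" and n: "n \<ge> 2"
  shows "R_function (assoc_fun p)"
    and "num_poles (assoc_fun p) = (if even n \<or> a1 \<noteq> 0 then n div 2 else n div 2 - 1)"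
    and "num_nonneg_poles (assoc_fun p) = (if even n \<or> a1 > 0 then k else k - 1)"
    and "odd n \<Longrightarrow> a1 \<le> 0 \<Longrightarrow> k \<ge> 1"
proof -
  let ?e = "even_part p" and ?f = "odd_part p"
  obtain \<mu> where "gen_hurwitz_data p k \<mu>" using gh by (rule gen_hurwitz_orderE)
  then interpret gen_hurwitz_data p k \<mu> .
  define l where "l = n div 2"
  define K where "K = (if even n \<or> a1 > 0 then k else k - 1)"
  define D where "D = (if even n \<or> a1 \<noteq> 0 then l else l - 1)"
  note zeros = even_part_interlacing_zeros[folded n_def a1_def, folded l_def, folded K_def D_def, OF n]
  have nl: "n = 2 * l \<or> n = 2 * l + 1" unfolding l_def by presburger
  have l: "l \<ge> 1" using n l_def by auto
  obtain x where dec: "\<And>i j. i < j \<Longrightarrow> j < D \<Longrightarrow> x j < x i" and KD: "K \<le> D"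
    and x: "\<And>j. j < D \<Longrightarrow> poly ?e (x j) = 0" "\<And>j. j < D \<Longrightarrow> (- 1) ^ (k - K + j) * poly ?f (x j) > 0"
      "\<And>j. j < D \<Longrightarrow> x j \<ge> 0 \<longleftrightarrow> j < K"
    using zeros(7) by blast
  have sign: "lead_coeff ?e * ((- 1) ^ j * poly ?f (x j)) > 0" if "j < D" for j
  proof -
    have "(lead_coeff ?e * (- 1) ^ (k - K)) * ((- 1) ^ (k - K + j) * poly ?f (x j)) > 0"
      using zeros(6) x(2)[OF that] by (rule mult_pos_pos)
    then show ?thesis by (cases "even (k - K)") (simp_all add: power_add)
  qed
  have f_coeff: "coeff ?f i = 0" if "i > l" for i
    using that nl unfolding coeff_odd_part n_def by (intro coeff_eq_0) auto
  have deg: "degree ?f \<le> D + 1"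
    by (intro degree_le allI impI f_coeff) (auto simp: D_def split: if_splits)
  have f_top: "coeff ?f (D + 1) = (if odd n \<and> a1 = 0 then lead_coeff p else 0)"
  proof (cases "odd n \<and> a1 = 0")
    case True
    then have "D + 1 = l" "n = 2 * l + 1" using l nl by (auto simp: D_def)
    then show ?thesis using True by (simp add: coeff_odd_part n_def)
  next
    case False
    then have "D = l" by (auto simp: D_def)
    then show ?thesis using False f_coeff[of "l + 1"] by auto
  qed
  have top: "lead_coeff ?e * coeff ?f (D + 1) \<le> 0"
  proof (cases "odd n \<and> a1 = 0")
    case True
    then have "K < k" using zeros(5) by simp
    then have "k - K = 1" using zeros(4) by simp
    then have "lead_coeff ?e < 0" using zeros(6) by simp
    moreover have "coeff ?f (D + 1) > 0" using lead True f_top by presburger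
    ultimately show ?thesis by (simp only: mult_neg_pos less_imp_le)
  next
    case False
    then have "coeff ?f (D + 1) = 0" using f_top by presburger
    then show ?thesis by simp
  qed
  have R: "D \<ge> 1 \<or> coeff ?f (D + 1) \<noteq> 0 \<Longrightarrow> R_function (assoc_fun p)"
    "{u. is_pole (assoc_fun p) u} = (\<lambda>j. complex_of_real (x j)) ` {..<D}"
    "inj_on (\<lambda>j. complex_of_real (x j)) {..<D}"
    using alternating_imp_R_function[OF zeros(1,2) dec x(1) sign deg top] by blast+
  have "D \<ge> 1 \<or> coeff ?f (D + 1) \<noteq> 0"
  proof (cases "D = l")
    case False
    then have "odd n \<and> a1 = 0" by (auto simp: D_def split: if_splits)
    then have "coeff ?f (D + 1) > 0" using lead f_top by presburger
    then show ?thesis by simp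
  qed (use l in simp)
  then show "R_function (assoc_fun p)" by (rule R(1))
  show "num_poles (assoc_fun p) = (if even n \<or> a1 \<noteq> 0 then n div 2 else n div 2 - 1)"
    unfolding num_poles_def R(2) l_def[symmetric] D_def[symmetric] using R(3) by (simp add: card_image)
  have "{u \<in> \<real>\<^sub>\<ge>\<^sub>0. is_pole (assoc_fun p) u} = {u. is_pole (assoc_fun p) u} \<inter> \<real>\<^sub>\<ge>\<^sub>0" by auto
  also have "\<dots> = (\<lambda>j. complex_of_real (x j)) ` {..<K}"
    unfolding R(2) using x(3) KD by (auto simp: nonneg_Reals_of_real_iff)
  finally have "num_nonneg_poles (assoc_fun p) = card ((\<lambda>j. complex_of_real (x j)) ` {..<K})"
    by (simp add: num_nonneg_poles_def)
  also have "\<dots> = K" using inj_on_subset[OF R(3), of "{..<K}"] KD by (simp add: card_image)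
  finally show "num_nonneg_poles (assoc_fun p) = (if even n \<or> a1 > 0 then k else k - 1)"
    by (simp only: K_def)
  show "k \<ge> 1" if "odd n" "a1 \<le> 0" using zeros(5) that by auto
qed

text \<open>
  If the second coefficient vanished, \<open>\<Phi>\<close> would decay at infinity at least as fast as \<open>u\<^bsup>-2\<^esup>\<close>, which no R-function
  does.
\<close>

lemma R_function_second_coeff:
  assumes R: "R_function (assoc_fun p)" and even: "even (degree p)" and deg: "degree p \<ge> 1"
    and lead: "lead_coeff p > 0"
  shows "coeff p (degree p - 1) \<noteq> 0"
proof
  assume 0: "coeff p (degree p - 1) = 0"
  define l where "l = degree p div 2"
  have l: "degree p = 2 * l" "l \<ge> 1" using even deg by (auto simp: l_def)
  have "l \<le> degree (even_part p)" using lead l by (intro le_degree) (auto simp: coeff_even_part)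
  also have "\<dots> \<le> degree (odd_part p) + 1" using R by (rule R_function_degree_odd_part)
  finally have "degree (odd_part p) \<ge> l - 1" by simp
  moreover have "coeff (odd_part p) i = 0" if "i \<ge> l - 1" for i
  proof (cases "i = l - 1")
    case True
    then have "2 * i + 1 = degree p - 1" using l by auto
    then show ?thesis using 0 by (simp add: coeff_odd_part)
  next
    case False
    then show ?thesis using that l by (auto simp: coeff_odd_part intro!: coeff_eq_0)
  qed
  ultimately have "lead_coeff (odd_part p) = 0" by blast
  then show False using R_function_odd_part[OF R] by simp
qed

lemma degree_even_part_le: "degree (even_part p) \<le> degree p div 2"
  by (rule degree_le) (auto simp: coeff_even_part intro!: coeff_eq_0)

lemma degree_1_even_odd:
  assumes "degree p = 1"
  shows "even_part p = [:coeff p 0:]" "odd_part p = [:coeff p 1:]"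
  using assms by (auto intro!: poly_eqI coeff_eq_0 simp: coeff_even_part coeff_odd_part coeff_pCons split: nat.splits)

lemma degree_1_root_iff:
  assumes "degree p = 1"
  shows "poly (cpoly p) z = 0 \<longleftrightarrow> z = of_real (- coeff p 0 / coeff p 1)"
proof -
  have "coeff p 1 \<noteq> 0" using assms leading_coeff_0_iff[of p] by auto
  moreover have "poly (cpoly p) z = of_real (coeff p 0) + z * of_real (coeff p 1)"
    unfolding cpoly_even_odd[of p z] degree_1_even_odd[OF assms] by (simp add: map_poly_pCons)
  moreover have "A + z * B = 0 \<longleftrightarrow> z = - A / B" if "B \<noteq> 0" for A B :: complex
    using that unfolding nonzero_eq_divide_eq[OF that] by (metis add.commute eq_neg_iff_add_eq_0)
  ultimately show ?thesis by simp
qed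

text \<open>
  In degree one \<open>\<Phi>\<close> is constant. It is not an R-function, but it satisfies \<open>\<Phi>' \<le> 0\<close>, which is all that the
  criterion asks for.
\<close>

lemma degree_1_generalized_hurwitz:
  assumes deg: "degree p = 1" and lead: "lead_coeff p > 0"
  shows "generalized_hurwitz p"
proof (rule generalized_hurwitzI[OF lead])
  show "z \<in> \<real>" if "poly (cpoly p) z = 0" for z
    using that degree_1_root_iff[OF deg] by simp
next
  have "coeff p 1 \<noteq> 0" using lead unfolding deg by simp
  then show "\<not> (poly (even_part p) x = 0 \<and> poly (odd_part p) x = 0)" for x
    unfolding degree_1_even_odd[OF deg] by simp
  show "poly (even_part p * pderiv (odd_part p) - pderiv (even_part p) * odd_part p) x \<le> 0" for x
    unfolding degree_1_even_odd[OF deg] by (simp add: pderiv_pCons)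
qed

lemma degree_1_order:
  assumes deg: "degree p = 1" and gh: "gen_hurwitz_order p k"
  shows "k = (if coeff p 0 > 0 then 0 else 1)" "num_nonneg_poles (assoc_fun p) = 0"
proof -
  obtain \<mu> where "gen_hurwitz_data p k \<mu>" using gh by (rule gen_hurwitz_orderE)
  then interpret gen_hurwitz_data p k \<mu> .
  have "coeff p 1 > 0" using lead unfolding deg .
  have "inj_on (\<lambda>i. complex_of_real (\<mu> i)) {1..k}"
    using strict_mono_on_imp_inj_on[OF mono] unfolding inj_on_def of_real_eq_iff .
  then have "k = card {z. poly (cpoly p) z = 0 \<and> Re z \<ge> 0}"
    unfolding closed_rhp by (simp add: card_image)
  also have "{z. poly (cpoly p) z = 0 \<and> Re z \<ge> 0} =
      (if coeff p 0 > 0 then {} else {of_real (- coeff p 0 / coeff p 1)})"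
    unfolding degree_1_root_iff[OF deg] using \<open>coeff p 1 > 0\<close> by (auto simp: divide_le_0_iff)
  finally show "k = (if coeff p 0 > 0 then 0 else 1)" by simp
  have "\<not> is_pole (assoc_fun p) u" for u
  proof (cases "even_part p = 0")
    case True
    then show ?thesis by (simp add: assoc_fun_even_part_0)
  next
    case False
    then show ?thesis using is_pole_assoc_fun_iff[OF False, of u]
      rational_not_pole(1)[of "cpoly (even_part p)" u "cpoly (odd_part p)"]
      unfolding degree_1_even_odd[OF deg] by (simp add: map_poly_pCons)
  qed
  then show "num_nonneg_poles (assoc_fun p) = 0" by (simp add: num_nonneg_poles_def)
qed

theorem theorem5p3:
  fixes p :: "real poly" and n l :: nat and a0 a1 :: real and \<Phi> :: "complex \<Rightarrow> complex"
  assumes "degree p = n" and "n \<ge> 1"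
    and "a0 = coeff p n" and "a1 = coeff p (n - 1)" and "a0 > 0"
    and "l = n div 2"
    and "\<Phi> = assoc_fun p"
  shows
    "(n \<ge> 2 \<longrightarrow>
        (generalized_hurwitz p \<longleftrightarrow>
           R_function \<Phi> \<and> num_poles \<Phi> = (if a1 \<noteq> 0 then l else l - 1))) \<and>
     (n = 1 \<longrightarrow> generalized_hurwitz p) \<and>
     (n = 2 * l \<and> R_function \<Phi> \<longrightarrow>
        a1 \<noteq> 0 \<and> (coprime (even_part p) (odd_part p) \<longrightarrow> num_poles \<Phi> = l)) \<and>
     (\<forall>k. gen_hurwitz_order p k \<longrightarrow>
        (n = 2 * l \<or> n = 2 * l + 1 \<and> a0 * a1 > 0 \<longrightarrow> num_nonneg_poles \<Phi> = k) \<and>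
        (n = 2 * l + 1 \<and> a0 * a1 \<le> 0 \<longrightarrow> int (num_nonneg_poles \<Phi>) = int k - 1))"
proof -
  have lead: "lead_coeff p > 0" using assms by simp
  have \<Phi>: "\<Phi> = assoc_fun p" by fact
  have a1: "a1 = coeff p (degree p - 1)" using assms by simp
  have l: "l = degree p div 2" using assms by simp
  have n: "n = degree p" using assms by simp
  have even_n: "even n \<longleftrightarrow> n = 2 * l" and odd_n: "odd n \<longleftrightarrow> n = 2 * l + 1"
    using \<open>l = n div 2\<close> by presburger+
  have sign: "a0 * a1 > 0 \<longleftrightarrow> a1 > 0" "a0 * a1 \<le> 0 \<longleftrightarrow> a1 \<le> 0"
    using \<open>a0 > 0\<close> by (auto simp: zero_less_mult_iff mult_le_0_iff)
  have a1_nz: "a1 \<noteq> 0" if "even n" "R_function \<Phi>"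
    unfolding a1 using that assms(2) lead unfolding \<Phi> n by (intro R_function_second_coeff)
  have forward: "R_function \<Phi> \<and> num_poles \<Phi> = (if a1 \<noteq> 0 then l else l - 1)"
    if n2: "n \<ge> 2" and gh: "generalized_hurwitz p"
  proof -
    obtain k where "gen_hurwitz_order p k" using gh unfolding generalized_hurwitz_def by blast
    note * = gen_hurwitz_order_imp_R_function[OF this n2[unfolded n], folded a1 n, folded \<Phi>]
    then show ?thesis using a1_nz l n by auto
  qed
  have backward: "generalized_hurwitz p"
    if n2: "n \<ge> 2" and R: "R_function \<Phi>" and poles: "num_poles \<Phi> = (if a1 \<noteq> 0 then l else l - 1)"
  proof (rule R_function_imp_generalized_hurwitz[OF lead R[unfolded \<Phi>]])
    have "degree (even_part p) \<le> l" using degree_even_part_le l by simp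
    \<comment> \<open>For \<open>a\<^sub>1 = 0\<close> the degree is odd, so \<open>a\<^sub>1\<close> is the coefficient of \<open>u\<^sup>l\<close> in the even part.\<close>
    moreover have "degree (even_part p) \<noteq> l" if "a1 = 0"
    proof
      assume "degree (even_part p) = l"
      moreover have "n = 2 * l + 1" using that a1_nz R odd_n by blast
      then have "coeff (even_part p) l = 0" using that a1 n by (simp add: coeff_even_part)
      ultimately show False using R_function_even_part[OF R[unfolded \<Phi>]] by (metis leading_coeff_0_iff)
    qed
    ultimately show "degree (even_part p) \<le> num_poles (assoc_fun p)"
      using poles unfolding \<Phi> by (cases "a1 = 0") auto
  qed
  have coprime_poles: "num_poles \<Phi> = l" if "even n" "R_function \<Phi>" "coprime (even_part p) (odd_part p)"
  proof -
    have "degree (even_part p) = l"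
    proof (rule antisym)
      show "degree (even_part p) \<le> l" using degree_even_part_le l by simp
      have "coeff (even_part p) l = lead_coeff p" using that(1) even_n n by (simp add: coeff_even_part)
      then show "l \<le> degree (even_part p)" using lead by (intro le_degree) auto
    qed
    then show ?thesis using num_poles_coprime that(2,3) unfolding \<Phi> by simp
  qed
  have count: "num_nonneg_poles \<Phi> = (if even n \<or> a1 > 0 then k else k - 1) \<and> (odd n \<and> a1 \<le> 0 \<longrightarrow> k \<ge> 1)"
    if gh: "gen_hurwitz_order p k" for k
  proof (cases "n \<ge> 2")
    case True
    show ?thesis
      using gen_hurwitz_order_imp_R_function(3,4)[OF gh True[unfolded n], folded a1 n, folded \<Phi>] by blast
  next
    case False
    then have "degree p = 1" using assms by simp
    from degree_1_order[OF this gh] show ?thesis unfolding a1 \<Phi> n using \<open>degree p = 1\<close> by auto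
  qed
  show ?thesis
    using forward backward a1_nz coprime_poles degree_1_generalized_hurwitz[OF _ lead] count n
    unfolding sign even_n[symmetric] odd_n[symmetric] by (auto split: if_splits)
qed

end
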